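(* Let $G=\varprojlim_{n\in\mathbb{N}}(L_n,p_n)$ be the inverse limit of an inverse system of finite discrete groups, where each $p_n\colon L_{n+1}\to L_n$ is an epimorphism, $L_0$ is the trivial group, and $|L_{n+1}|\ge 2|L_n|$ for each $n$ (i.e. no $p_n$ is injective). Equip $G$ with the ultrametric $d$ where, for distinct $x,y\in G$, $d(x,y)=1/|L_n|$ for the largest $n$ such that the natural projections of $x$ and $y$ into $L_n$ are equal (and $d(x,x)=0$). Let $U$ be a closed subgroup of $G$ and let $U_n$ be the projection of $U$ into $L_n$. Then $$\dim_H(U)=\underline{\dim}_B(U)=\liminf_{n}\frac{\log|U_n|}{\log|L_n|}$$ and $$\dim_P(U)=\overline{\dim}_B(U)=\limsup_{n}\frac{\log|U_n|}{\log|L_{n-1}|}.$$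
   Context: Let $X$ be a bounded subset of a metric space $M$; here $M=G$ and $X=U$. Box dimensions: let $N_\alpha(X)$ be the least cardinality of a covering of $X$ by sets of diameter at most $\alpha$. Then $$\underline{\dim}_B(X)=\liminf_{\alpha\to0^+}\frac{\log N_\alpha(X)}{\log(1/\alpha)},\qquad \overline{\dim}_B(X)=\limsup_{\alpha\to0^+}\frac{\log N_\alpha(X)}{\log(1/\alpha)}.$$ Hausdorff dimension: for $r\ge0$, $H^r(X)=\lim_{\alpha\to0^+}\inf\sum_{i\in I}\operatorname{diam}(E_i)^r$, where the infimum is over all countable covers $(E_i)_{i\in I}$ of $X$ by sets of diameter at most $\alpha$, and $\dim_H(X)$ is the supremum of the $r$ such that $H^r(X)>0$. Packing dimension: for $r\ge0$, $$P^r(X)=\inf_{\mathcal V}\Big\{\sum_{V\in\mathcal V}\ \lim_{\alpha\to0^+}\Big(\sup\sum_{i\in I}\operatorname{diam}(E_i^V)^r\Big)\Big\},$$ where the infimum is over all countable coverings $\mathcal V$ of $X$, and the inner suprema are over all countable collections $(E_i^V)_{i\in I}$ of disjoint open balls with center in $V$ and diameter at most $\alpha$. Then $\dim_P(X)$ is the supremum of the $r$ such that $P^r(X)>0$.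
   Formalization: In the packing measure, the diameter of an open ball is taken to be twice its radius instead of the diameter of the ball as a set; with set diameter the packing claim fails, e.g. for U = G with |L_n| = 2^(2^n) for n ≥ 1, where dim_P ≤ 1 but the limsup is 2. *)

theory Defs
  imports "HOL-Analysis.Analysis" "HOL-Algebra.Product_Groups"
begin

section \<open>Dimensions of a subset \<open>X\<close> of a metric space \<open>(M, d)\<close>\<close>

definition ediameter :: "('a \<Rightarrow> 'a \<Rightarrow> real) \<Rightarrow> 'a set \<Rightarrow> ennreal" where
  "ediameter d E = (SUP x\<in>E. SUP y\<in>E. ennreal (d x y))"

definition small_covers :: "'a set \<Rightarrow> ('a \<Rightarrow> 'a \<Rightarrow> real) \<Rightarrow> real \<Rightarrow> 'a set \<Rightarrow> 'a set set set" where
  "small_covers M d \<alpha> X =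
     {C. C \<subseteq> Pow M \<and> X \<subseteq> \<Union>C \<and> (\<forall>E\<in>C. ediameter d E \<le> ennreal \<alpha>)}"

subsection \<open>Box dimensions\<close>

definition covering_number :: "'a set \<Rightarrow> ('a \<Rightarrow> 'a \<Rightarrow> real) \<Rightarrow> real \<Rightarrow> 'a set \<Rightarrow> enat" where
  "covering_number M d \<alpha> X =
     (INF C\<in>small_covers M d \<alpha> X. if finite C then enat (card C) else \<infinity>)"

definition log_enat :: "enat \<Rightarrow> ereal" where
  "log_enat k = (case k of enat n \<Rightarrow> (if n = 0 then -\<infinity> else ereal (ln (real n))) | \<infinity> \<Rightarrow> \<infinity>)"

definition lower_box_dim :: "'a set \<Rightarrow> ('a \<Rightarrow> 'a \<Rightarrow> real) \<Rightarrow> 'a set \<Rightarrow> ereal" where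
  "lower_box_dim M d X =
     Liminf (at_right 0) (\<lambda>\<alpha>. log_enat (covering_number M d \<alpha> X) / ereal (ln (1 / \<alpha>)))"

definition upper_box_dim :: "'a set \<Rightarrow> ('a \<Rightarrow> 'a \<Rightarrow> real) \<Rightarrow> 'a set \<Rightarrow> ereal" where
  "upper_box_dim M d X =
     Limsup (at_right 0) (\<lambda>\<alpha>. log_enat (covering_number M d \<alpha> X) / ereal (ln (1 / \<alpha>)))"

subsection \<open>Hausdorff dimension\<close>

text \<open>
  The power \<open>t ^ r\<close> of a diameter \<open>t\<close>, with the convention \<open>0 ^ 0 = 1\<close> that makes \<open>H^0\<close> the
  counting measure (whereas \<open>0 powr 0 = 0\<close>). Only finite \<open>t\<close> occur below.
\<close>

definition diam_power :: "ennreal \<Rightarrow> real \<Rightarrow> ennreal" where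
  "diam_power t r = (if r = 0 then 1 else ennreal (enn2real t powr r))"

definition hausdorff_measure :: "'a set \<Rightarrow> ('a \<Rightarrow> 'a \<Rightarrow> real) \<Rightarrow> real \<Rightarrow> 'a set \<Rightarrow> ennreal" where
  "hausdorff_measure M d r X =
     Lim (at_right (0::real))
       (\<lambda>\<alpha>. INF C\<in>{C \<in> small_covers M d \<alpha> X. countable C}.
              (\<Sum>\<^sub>\<infinity>E\<in>C. diam_power (ediameter d E) r))"

definition hausdorff_dim :: "'a set \<Rightarrow> ('a \<Rightarrow> 'a \<Rightarrow> real) \<Rightarrow> 'a set \<Rightarrow> ereal" where
  "hausdorff_dim M d X = Sup {ereal r | r. 0 \<le> r \<and> hausdorff_measure M d r X > 0}"

subsection \<open>Packing dimension\<close>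

text \<open>
  A packing is a collection of pairs \<open>(x, \<rho>)\<close>, standing for the open balls of centre \<open>x\<close> and
  radius \<open>\<rho>\<close>. As usual for packing measures, the diameter of such a ball is its nominal diameter
  \<open>2 * \<rho>\<close>. In an ultrametric space this can exceed the diameter of the underlying point set (which
  does not determine \<open>\<rho>\<close>), and using the latter would give a different dimension, in general
  unequal to the upper box dimension for closed subgroups of profinite groups.
\<close>

definition small_packings ::
    "'a set \<Rightarrow> ('a \<Rightarrow> 'a \<Rightarrow> real) \<Rightarrow> real \<Rightarrow> 'a set \<Rightarrow> ('a \<times> real) set set" where
  "small_packings M d \<alpha> V =
     {C. countable C \<and> (\<forall>(x, \<rho>)\<in>C. x \<in> V \<and> 0 < \<rho> \<and> 2 * \<rho> \<le> \<alpha>) \<and>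
         disjoint_family_on (\<lambda>(x, \<rho>). Metric_space.mball M d x \<rho>) C}"

definition packing_premeasure :: "'a set \<Rightarrow> ('a \<Rightarrow> 'a \<Rightarrow> real) \<Rightarrow> real \<Rightarrow> 'a set \<Rightarrow> ennreal" where
  "packing_premeasure M d r V =
     Lim (at_right (0::real))
       (\<lambda>\<alpha>. SUP C\<in>small_packings M d \<alpha> V. (\<Sum>\<^sub>\<infinity>(x, \<rho>)\<in>C. ennreal ((2 * \<rho>) powr r)))"

definition packing_measure :: "'a set \<Rightarrow> ('a \<Rightarrow> 'a \<Rightarrow> real) \<Rightarrow> real \<Rightarrow> 'a set \<Rightarrow> ennreal" where
  "packing_measure M d r X =
     (INF \<V>\<in>{\<V>. countable \<V> \<and> \<V> \<subseteq> Pow M \<and> X \<subseteq> \<Union>\<V>}.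
        (\<Sum>\<^sub>\<infinity>V\<in>\<V>. packing_premeasure M d r V))"

definition packing_dim :: "'a set \<Rightarrow> ('a \<Rightarrow> 'a \<Rightarrow> real) \<Rightarrow> 'a set \<Rightarrow> ereal" where
  "packing_dim M d X = Sup {ereal r | r. 0 \<le> r \<and> packing_measure M d r X > 0}"


section \<open>Inverse limits of sequences of groups\<close>

definition inverse_limit ::
    "(nat \<Rightarrow> ('a, 'b) monoid_scheme) \<Rightarrow> (nat \<Rightarrow> 'a \<Rightarrow> 'a) \<Rightarrow> (nat \<Rightarrow> 'a) monoid" where
  "inverse_limit L p =
     (product_group UNIV L)
       \<lparr>carrier := {x \<in> carrier (product_group UNIV L). \<forall>n. p n (x (Suc n)) = x n}\<rparr>"

definition inverse_limit_topology ::
    "(nat \<Rightarrow> ('a, 'b) monoid_scheme) \<Rightarrow> (nat \<Rightarrow> 'a \<Rightarrow> 'a) \<Rightarrow> (nat \<Rightarrow> 'a) topology" where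
  "inverse_limit_topology L p =
     subtopology (product_topology (\<lambda>n. discrete_topology (carrier (L n))) UNIV)
       (carrier (inverse_limit L p))"

definition inverse_limit_dist ::
    "(nat \<Rightarrow> ('a, 'b) monoid_scheme) \<Rightarrow> (nat \<Rightarrow> 'a) \<Rightarrow> (nat \<Rightarrow> 'a) \<Rightarrow> real" where
  "inverse_limit_dist L x y =
     (if x = y then 0 else 1 / real (card (carrier (L (GREATEST n. x n = y n)))))"

lemma carrier_inverse_limit:
  "carrier (inverse_limit L p) = {x. (\<forall>n. x n \<in> carrier (L n)) \<and> (\<forall>n. p n (x (Suc n)) = x n)}"
  by (auto simp: inverse_limit_def)

lemma inverse_limit_agree_le:
  assumes "x \<in> carrier (inverse_limit L p)" "y \<in> carrier (inverse_limit L p)"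
    and "x n = y n" "m \<le> n"
  shows "x m = y m"
  using assms(4,3)
proof (induction rule: inc_induct)
  case (step k)
  then show ?case
    using assms(1,2) by (simp add: carrier_inverse_limit) metis
qed

lemma Metric_space_inverse_limit:
  assumes fin: "\<And>n. finite (carrier (L n))"
    and triv: "trivial_group (L 0)"
    and card: "\<And>n. card (carrier (L (Suc n))) \<ge> 2 * card (carrier (L n))"
  shows "Metric_space (carrier (inverse_limit L p)) (inverse_limit_dist L)"
proof
  let ?G = "carrier (inverse_limit L p)"
  let ?g = "\<lambda>x y. GREATEST n. x n = y n"
  have mono: "card (carrier (L m)) \<le> card (carrier (L n))" if "m \<le> n" for m n
  proof (rule lift_Suc_mono_le[OF _ that])
    show "card (carrier (L k)) \<le> card (carrier (L (Suc k)))" for k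
      using card[of k] by simp
  qed
  have pos: "card (carrier (L n)) > 0" for n
  proof -
    have "card (carrier (L 0)) = 1" using triv by (simp add: trivial_group_def)
    then show ?thesis using mono[of 0 n] by simp
  qed
  have bound: "n \<le> m" if "x \<in> ?G" "y \<in> ?G" "x m \<noteq> y m" "x n = y n" for x y m n
    using inverse_limit_agree_le[of x L p y n m] that by (meson nat_le_linear)
  have agree: "x (?g x y) = y (?g x y)" if G: "x \<in> ?G" "y \<in> ?G" "x \<noteq> y" for x y
  proof -
    obtain m where m: "x m \<noteq> y m" using G by blast
    have "x 0 \<in> carrier (L 0)" "y 0 \<in> carrier (L 0)"
      using G by (simp_all add: carrier_inverse_limit)
    then have "x 0 = y 0" using triv by (simp add: trivial_group_def)
    then show ?thesis
      using GreatestI_nat[of "\<lambda>n. x n = y n" 0 m] bound[OF G(1,2) m] by blast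
  qed
  have le: "k \<le> ?g x y" if G: "x \<in> ?G" "y \<in> ?G" "x \<noteq> y" "x k = y k" for x y k
  proof -
    obtain m where m: "x m \<noteq> y m" using G by blast
    show ?thesis using Greatest_le_nat[of "\<lambda>n. x n = y n" k m] bound[OF G(1,2) m] G by blast
  qed
  show "0 \<le> inverse_limit_dist L x y" for x y by (simp add: inverse_limit_dist_def)
  show "inverse_limit_dist L x y = inverse_limit_dist L y x" for x y
    by (simp add: inverse_limit_dist_def eq_commute)
  show "(inverse_limit_dist L x y = 0) = (x = y)" for x y
    using pos by (auto simp: inverse_limit_dist_def simp del: card_gt_0_iff)
  show "inverse_limit_dist L x z \<le> inverse_limit_dist L x y + inverse_limit_dist L y z"
    if G: "x \<in> ?G" "y \<in> ?G" "z \<in> ?G" for x y z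
  proof (cases "x = y \<or> y = z \<or> x = z")
    case True then show ?thesis by (auto simp: inverse_limit_dist_def)
  next
    case False
    define k where "k = min (?g x y) (?g y z)"
    have "x (?g x y) = y (?g x y)" "y (?g y z) = z (?g y z)"
      using agree G False by blast+
    then have "x k = y k" "y k = z k"
      using inverse_limit_agree_le[of x L p y "?g x y" k]
        inverse_limit_agree_le[of y L p z "?g y z" k] G by (auto simp: k_def)
    then have "k \<le> ?g x z" using le G False by simp
    then have "1 / real (card (carrier (L (?g x z)))) \<le> 1 / real (card (carrier (L k)))"
      using mono pos by (intro divide_left_mono) (auto simp del: card_gt_0_iff)
    also have "\<dots> \<le> 1 / real (card (carrier (L (?g x y)))) + 1 / real (card (carrier (L (?g y z))))"
      unfolding k_def min_def by simp
    finally show ?thesis using False by (simp add: inverse_limit_dist_def)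
  qed
qed

end

theory Submission
  imports Defs "HOL-Real_Asymp.Real_Asymp"
begin

text \<open>
  Write \<open>l n = |L\<^sub>n|\<close> and \<open>u n = |U\<^sub>n|\<close>. A set of diameter at most \<open>\<alpha>\<close> with
  \<open>1 / l n \<le> \<alpha> < 1 / l (n - 1)\<close> lies in a cylinder of level \<open>n\<close>, so \<open>u n\<close> is the covering number;
  the ratio \<open>ln (u n) / ln (1 / \<alpha>)\<close> ranges between \<open>ln (u n) / ln (l n)\<close> and
  \<open>ln (u n) / ln (l (n - 1))\<close>, which gives the box dimensions. For the lower bound on the Hausdorff
  dimension we compare with Haar measure, which gives mass \<open>1 / u n\<close> to a cylinder of level \<open>n\<close>;
  compactness of \<open>U\<close> reduces this to counting finitely many cylinders. The same count bounds the
  packing dimension from above. For the lower bound, the Baire category theorem shows that in a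
  countable cover some member is dense in a cylinder, so that it contains packings by as many
  balls of radius \<open>1 / l (n - 1)\<close>, up to a constant factor, as \<open>U\<close> itself.
\<close>

section \<open>Monotone one-sided limits and infinite sums\<close>

lemma Lim_at_right_antimono:
  fixes h :: "real \<Rightarrow> 'a :: {complete_linorder, linorder_topology}"
  assumes "\<And>a b. 0 < a \<Longrightarrow> a \<le> b \<Longrightarrow> h b \<le> h a"
  shows "Lim (at_right 0) h = (SUP a\<in>{0<..}. h a)"
proof (rule tendsto_Lim)
  show "(h \<longlongrightarrow> (SUP a\<in>{0<..}. h a)) (at_right 0)"
  proof (rule order_tendstoI)
    fix c assume "c < (SUP a\<in>{0<..}. h a)"
    then obtain b where "0 < b" "c < h b" by (auto simp: less_SUP_iff)
    then show "\<forall>\<^sub>F a in at_right 0. c < h a"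
      unfolding eventually_at_right_field using assms[of _ b]
      by (intro exI[of _ b]) (auto intro: less_le_trans)
  next
    fix c assume c: "(SUP a\<in>{0<..}. h a) < c"
    show "\<forall>\<^sub>F a in at_right 0. h a < c"
      unfolding eventually_at_right_field
      by (intro exI[of _ 1]) (auto intro!: le_less_trans[OF SUP_upper c])
  qed
qed simp

lemma Lim_at_right_mono:
  fixes h :: "real \<Rightarrow> 'a :: {complete_linorder, linorder_topology}"
  assumes "\<And>a b. 0 < a \<Longrightarrow> a \<le> b \<Longrightarrow> h a \<le> h b"
  shows "Lim (at_right 0) h = (INF a\<in>{0<..}. h a)"
proof (rule tendsto_Lim)
  show "(h \<longlongrightarrow> (INF a\<in>{0<..}. h a)) (at_right 0)"
  proof (rule order_tendstoI)
    fix c assume "(INF a\<in>{0<..}. h a) < c"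
    then obtain b where "0 < b" "h b < c" by (auto simp: INF_less_iff)
    then show "\<forall>\<^sub>F a in at_right 0. h a < c"
      unfolding eventually_at_right_field using assms[of _ b]
      by (metis le_less_trans less_imp_le)
  next
    fix c assume c: "c < (INF a\<in>{0<..}. h a)"
    show "\<forall>\<^sub>F a in at_right 0. c < h a"
      unfolding eventually_at_right_field
      by (intro exI[of _ 1]) (auto intro!: less_le_trans[OF c INF_lower])
  qed
qed simp

lemma sum_le_infsum_ennreal:
  fixes f :: "'a \<Rightarrow> ennreal"
  assumes "finite F" "F \<subseteq> A"
  shows "sum f F \<le> infsum f A"
  using assms by (subst nonneg_infsum_complete) (auto intro: SUP_upper)

lemma infsum_le_ennreal:
  fixes f :: "'a \<Rightarrow> ennreal"
  assumes "\<And>F. finite F \<Longrightarrow> F \<subseteq> A \<Longrightarrow> sum f F \<le> b"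
  shows "infsum f A \<le> b"
  using assms by (intro infsum_le_finite_sums nonneg_summable_on_complete) auto

lemma sum_geometric_to_nat_on_le:
  assumes "countable A" "finite F" "F \<subseteq> A"
  shows "(\<Sum>x\<in>F. (1/2) ^ Suc (to_nat_on A x)) \<le> (1::real)"
proof -
  have "(\<Sum>x\<in>F. (1/2) ^ Suc (to_nat_on A x)) = (\<Sum>k\<in>to_nat_on A ` F. (1/2) ^ Suc k :: real)"
    using inj_on_to_nat_on[OF assms(1)] assms(3)
    by (subst sum.reindex) (auto intro: inj_on_subset)
  also have "\<dots> \<le> (\<Sum>k. (1/2) ^ Suc k)"
    using power_half_series assms(2) by (intro sum_le_suminf) (auto simp: sums_iff)
  also have "\<dots> = 1" using power_half_series by (simp add: sums_iff)
  finally show ?thesis .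
qed

section \<open>The inverse limit and its metric\<close>

lemma mult_inverse_limit [simp]:
  "x \<otimes>\<^bsub>inverse_limit L p\<^esub> y = (\<lambda>n. x n \<otimes>\<^bsub>L n\<^esub> y n)"
  by (simp add: inverse_limit_def fun_eq_iff)

lemma one_inverse_limit [simp]: "\<one>\<^bsub>inverse_limit L p\<^esub> = (\<lambda>n. \<one>\<^bsub>L n\<^esub>)"
  by (simp add: inverse_limit_def fun_eq_iff)

lemma group_inverse_limit:
  assumes group: "\<And>n. group (L n)" and hom: "\<And>n. p n \<in> hom (L (Suc n)) (L n)"
  shows "group (inverse_limit L p)"
proof -
  have hg: "group_hom (L (Suc n)) (L n) (p n)" for n
    by (intro group_hom.intro group_hom_axioms.intro group hom)
  have "subgroup {x \<in> carrier (product_group UNIV L). \<forall>n. p n (x (Suc n)) = x n}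
          (product_group UNIV L)"
    using group
    by (intro group.subgroupI product_group)
      (auto simp: group_hom.hom_mult[OF hg] group_hom.hom_one[OF hg] group_hom.hom_inv[OF hg]
        group.is_monoid monoid.m_closed PiE_iff
        intro!: exI[of _ "\<lambda>n. \<one>\<^bsub>L n\<^esub>"])
  from subgroup.subgroup_is_group[OF this product_group[OF group]] show ?thesis
    by (simp add: inverse_limit_def)
qed

locale closed_subgroup_inverse_limit =
  fixes L :: "nat \<Rightarrow> ('a, 'b) monoid_scheme"
    and p :: "nat \<Rightarrow> 'a \<Rightarrow> 'a"
    and U :: "(nat \<Rightarrow> 'a) set"
  assumes group: "\<And>n. group (L n)"
    and finite_carrier: "\<And>n. finite (carrier (L n))"
    and hom: "\<And>n. p n \<in> hom (L (Suc n)) (L n)"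
    and trivial: "trivial_group (L 0)"
    and growth: "\<And>n. card (carrier (L (Suc n))) \<ge> 2 * card (carrier (L n))"
    and subgroup: "subgroup U (inverse_limit L p)"
    and closed: "closedin (inverse_limit_topology L p) U"
begin

abbreviation G where "G \<equiv> carrier (inverse_limit L p)"
abbreviation d where "d \<equiv> inverse_limit_dist L"

definition l :: "nat \<Rightarrow> real" where "l n = real (card (carrier (L n)))"
definition u :: "nat \<Rightarrow> real" where "u n = real (card ((\<lambda>x. x n) ` U))"

lemma l_0 [simp]: "l 0 = 1"
  using trivial by (simp add: l_def trivial_group_def)

lemma l_Suc_ge: "2 * l n \<le> l (Suc n)"
  using growth[of n] unfolding l_def by linarith

lemma l_ge_power: "2 ^ n \<le> l n"
proof (induction n)
  case (Suc n)
  then show ?case using l_Suc_ge[of n] by simp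
qed simp

lemma l_ge_1: "1 \<le> l n"
  using l_ge_power[of n] one_le_power[of "2::real" n] by linarith

lemma l_pos [simp]: "0 < l n"
  using l_ge_1[of n] by linarith

lemma l_neq_0 [simp]: "l n \<noteq> 0"
  using l_pos[of n] by linarith

lemma l_mono: "m \<le> n \<Longrightarrow> l m \<le> l n"
proof (rule lift_Suc_mono_le[of l])
  show "l k \<le> l (Suc k)" for k using l_Suc_ge[of k] l_pos[of k] by linarith
qed

lemma l_ge_2: "1 \<le> n \<Longrightarrow> 2 \<le> l n"
  using l_mono[of 1 n] l_Suc_ge[of 0] by simp

lemma l_less: "l n < l (Suc n)"
  using l_Suc_ge[of n] l_pos[of n] by linarith

lemma filterlim_l: "filterlim l at_top sequentially"
proof (rule filterlim_at_top_mono)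
  show "filterlim (\<lambda>n. 2 ^ n :: real) at_top sequentially" by real_asymp
qed (use l_ge_power in \<open>auto intro: always_eventually\<close>)

lemma U_subset: "U \<subseteq> G"
  using subgroup by (rule subgroup.subset)

lemma U_nonempty: "U \<noteq> {}"
  using subgroup.one_closed[OF subgroup] by blast

lemma in_carrier: "x \<in> G \<Longrightarrow> x n \<in> carrier (L n)"
  by (simp add: carrier_inverse_limit)

lemma finite_proj: "S \<subseteq> G \<Longrightarrow> finite ((\<lambda>x. x n) ` S)"
  by (rule finite_subset[OF _ finite_carrier[of n]]) (auto intro: in_carrier)

lemma u_ge_1: "1 \<le> u n"
proof -
  have "card ((\<lambda>x. x n) ` U) \<noteq> 0"
    using finite_proj[OF U_subset] U_nonempty by simp
  then show ?thesis by (simp add: u_def)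
qed

lemma u_pos [simp]: "0 < u n"
  using u_ge_1[of n] by linarith

lemma agree_le: "x \<in> G \<Longrightarrow> y \<in> G \<Longrightarrow> x n = y n \<Longrightarrow> m \<le> n \<Longrightarrow> x m = y m"
  by (rule inverse_limit_agree_le)

lemma agree_0: "x \<in> G \<Longrightarrow> y \<in> G \<Longrightarrow> x 0 = y 0"
  using in_carrier[of x 0] in_carrier[of y 0] trivial by (simp add: trivial_group_def)

sublocale Metric_space G d
  by (rule Metric_space_inverse_limit[where L = L and p = p, OF finite_carrier trivial growth])

lemma dist_eq:
  assumes "x \<in> G" "y \<in> G" "x k = y k" "x (Suc k) \<noteq> y (Suc k)"
  shows "d x y = 1 / l k"
proof -
  have "(GREATEST n. x n = y n) = k"
    using assms agree_le[OF assms(1,2), of _ "Suc k"]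
    by (intro Greatest_equality) (auto simp: not_less_eq_eq[symmetric])
  then show ?thesis using assms by (auto simp: inverse_limit_dist_def l_def)
qed

lemma dist_cases:
  assumes "x \<in> G" "y \<in> G"
  obtains "x = y" "d x y = 0"
  | k where "x k = y k" "x (Suc k) \<noteq> y (Suc k)" "d x y = 1 / l k"
proof (cases "x = y")
  case False
  then obtain m where "x m \<noteq> y m" by blast
  then obtain k where "x k = y k" "x (Suc k) \<noteq> y (Suc k)"
    using agree_0[OF assms] nat_induct[of "\<lambda>n. x n = y n" m] by blast
  then show ?thesis using that(2) dist_eq[OF assms] by blast
qed (use that(1) assms in simp)

lemma dist_le_iff:
  assumes "x \<in> G" "y \<in> G" "1 / l n \<le> \<alpha>" "n = 0 \<or> \<alpha> < 1 / l (n - 1)"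
  shows "d x y \<le> \<alpha> \<longleftrightarrow> x n = y n"
proof (cases rule: dist_cases[OF assms(1,2)])
  case 1
  then show ?thesis using assms(3) l_pos[of n] by (smt (verit) divide_pos_pos)
next
  case (2 k)
  show ?thesis
  proof (cases "n \<le> k")
    case True
    then have "1 / l k \<le> 1 / l n" using l_mono[of n k] by (intro divide_left_mono) auto
    then show ?thesis using 2 True assms agree_le[OF assms(1,2), of k n] by auto
  next
    case False
    then have "1 / l (n - 1) \<le> 1 / l k" using l_mono[of k "n - 1"]
      by (intro divide_left_mono) auto
    moreover have "x n \<noteq> y n" using False 2 agree_le[OF assms(1,2), of n "Suc k"] by auto
    ultimately show ?thesis using 2 False assms by auto
  qed
qed

lemma dist_le_iff_agree: "x \<in> G \<Longrightarrow> y \<in> G \<Longrightarrow> d x y \<le> 1 / l n \<longleftrightarrow> x n = y n"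
  by (rule dist_le_iff) (cases n; simp add: divide_strict_left_mono l_less)+

lemma dist_less_iff:
  assumes "x \<in> G" "y \<in> G" "1 / l n < \<rho>" "n = 0 \<or> \<rho> \<le> 1 / l (n - 1)"
  shows "d x y < \<rho> \<longleftrightarrow> x n = y n"
proof
  assume "x n = y n"
  then show "d x y < \<rho>" using dist_le_iff_agree[OF assms(1,2), of n] assms(3) by simp
next
  assume *: "d x y < \<rho>"
  show "x n = y n"
  proof (cases rule: dist_cases[OF assms(1,2)])
    case (2 k)
    have "l (n - 1) < l k" if "n \<noteq> 0"
    proof -
      have "1 / l k < 1 / l (n - 1)" using 2 * assms(4) that by auto
      then show ?thesis by (simp add: field_simps)
    qed
    then have "n \<le> k" using l_mono[of k "n - 1"] by fastforce
    then show ?thesis using 2 agree_le[OF assms(1,2)] by blast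
  qed auto
qed

section \<open>Counting cylinders\<close>

text \<open>The summands \<open>1 / u n\<close> below are Haar measures of cylinders of level \<open>n\<close>.\<close>

definition cylinder :: "(nat \<Rightarrow> 'a) \<Rightarrow> nat \<Rightarrow> (nat \<Rightarrow> 'a) set" where
  "cylinder x n = {y \<in> U. y n = x n}"

lemma mem_cylinder: "x \<in> U \<Longrightarrow> x \<in> cylinder x n"
  by (simp add: cylinder_def)

lemma cylinder_subset: "cylinder x n \<subseteq> U"
  by (auto simp: cylinder_def)

lemma card_proj_cylinder_le:
  assumes x: "x \<in> U" and z: "z \<in> U"
  shows "card ((\<lambda>y. y N) ` cylinder z n) \<le> card ((\<lambda>y. y N) ` cylinder x n)"
proof -
  interpret I: group "inverse_limit L p" by (rule group_inverse_limit[where L = L and p = p, OF group hom])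
  define g where "g = x \<otimes>\<^bsub>inverse_limit L p\<^esub> inv\<^bsub>inverse_limit L p\<^esub> z"
  have g: "g \<in> U" unfolding g_def using subgroup x z
    by (intro subgroup.m_closed subgroup.m_inv_closed)
  have "g \<otimes>\<^bsub>inverse_limit L p\<^esub> z = x"
    unfolding g_def using x z U_subset by (simp add: subset_iff I.m_assoc I.l_inv del: mult_inverse_limit one_inverse_limit)
  then have gz: "g n \<otimes>\<^bsub>L n\<^esub> z n = x n" by (simp add: fun_eq_iff)
  show ?thesis
  proof (rule card_inj_on_le)
    show "inj_on (\<lambda>v. g N \<otimes>\<^bsub>L N\<^esub> v) ((\<lambda>y. y N) ` cylinder z n)"
      using g U_subset group
      by (intro inj_on_subset[OF group.inj_on_cmult]) (auto simp: cylinder_def in_carrier subset_iff)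
    show "(\<lambda>v. g N \<otimes>\<^bsub>L N\<^esub> v) ` (\<lambda>y. y N) ` cylinder z n \<subseteq> (\<lambda>y. y N) ` cylinder x n"
    proof (clarsimp simp: cylinder_def)
      fix y assume y: "y \<in> U" "y n = z n"
      have "g \<otimes>\<^bsub>inverse_limit L p\<^esub> y \<in> U" by (rule subgroup.m_closed[OF subgroup g y(1)])
      then show "g N \<otimes>\<^bsub>L N\<^esub> y N \<in> (\<lambda>y. y N) ` {y \<in> U. y n = x n}"
        using gz y by (intro image_eqI[of _ _ "g \<otimes>\<^bsub>inverse_limit L p\<^esub> y"]) auto
    qed
    show "finite ((\<lambda>y. y N) ` cylinder x n)"
      using cylinder_subset U_subset by (intro finite_proj) blast
  qed
qed

lemma card_proj_cylinder:
  assumes x: "x \<in> U" and "n \<le> N"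
  shows "real (card ((\<lambda>y. y N) ` cylinder x n)) = u N / u n"
proof -
  define A where "A = (\<lambda>y. y n) ` U"
  obtain s where s: "\<And>a. a \<in> A \<Longrightarrow> s a \<in> U \<and> s a n = a"
    unfolding A_def by (metis imageE)
  have "(\<lambda>y. y N) ` U = (\<Union>a\<in>A. (\<lambda>y. y N) ` cylinder (s a) n)"
    using s by (force simp: cylinder_def A_def)
  moreover have "card (\<Union>a\<in>A. (\<lambda>y. y N) ` cylinder (s a) n)
      = (\<Sum>a\<in>A. card ((\<lambda>y. y N) ` cylinder (s a) n))"
  proof (rule card_UN_disjoint)
    show "finite A" unfolding A_def by (rule finite_proj[OF U_subset])
    show "\<forall>a\<in>A. finite ((\<lambda>y. y N) ` cylinder (s a) n)"
      using cylinder_subset U_subset by (intro ballI finite_proj) blast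
    show "\<forall>a\<in>A. \<forall>b\<in>A. a \<noteq> b \<longrightarrow>
        (\<lambda>y. y N) ` cylinder (s a) n \<inter> (\<lambda>y. y N) ` cylinder (s b) n = {}"
    proof (intro ballI impI equals0I)
      fix a b v assume ab: "a \<in> A" "b \<in> A" "a \<noteq> b"
        and "v \<in> (\<lambda>y. y N) ` cylinder (s a) n \<inter> (\<lambda>y. y N) ` cylinder (s b) n"
      then obtain y z where "y \<in> U" "y n = a" "z \<in> U" "z n = b" "y N = z N"
        using s by (auto simp: cylinder_def)
      then show False using agree_le[of y z N n] U_subset \<open>n \<le> N\<close> \<open>a \<noteq> b\<close> by blast
    qed
  qed
  moreover have "card ((\<lambda>y. y N) ` cylinder (s a) n) = card ((\<lambda>y. y N) ` cylinder x n)"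
    if "a \<in> A" for a
    using s[OF that] x by (intro antisym card_proj_cylinder_le) auto
  ultimately have "card ((\<lambda>y. y N) ` U) = card A * card ((\<lambda>y. y N) ` cylinder x n)"
    by simp
  then have "u N = u n * real (card ((\<lambda>y. y N) ` cylinder x n))"
    unfolding u_def A_def by simp
  then show ?thesis using u_pos[of n] by (simp add: field_simps del: u_pos)
qed

lemma sum_cylinder_cover_ge_1:
  assumes fin: "finite I" and x: "\<And>i. i \<in> I \<Longrightarrow> x i \<in> U"
    and cover: "U \<subseteq> (\<Union>i\<in>I. cylinder (x i) (n i))"
  shows "1 \<le> (\<Sum>i\<in>I. 1 / u (n i))"
proof -
  define N where "N = Max (n ` I)"
  have N: "n i \<le> N" if "i \<in> I" for i using fin that by (simp add: N_def)
  have "(\<lambda>y. y N) ` U \<subseteq> (\<Union>i\<in>I. (\<lambda>y. y N) ` cylinder (x i) (n i))"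
    using cover by blast
  then have "card ((\<lambda>y. y N) ` U) \<le> card (\<Union>i\<in>I. (\<lambda>y. y N) ` cylinder (x i) (n i))"
    using fin finite_proj[OF subset_trans[OF cylinder_subset U_subset]]
    by (intro card_mono) auto
  also have "\<dots> \<le> (\<Sum>i\<in>I. card ((\<lambda>y. y N) ` cylinder (x i) (n i)))"
    by (rule card_UN_le[OF fin])
  finally have "u N \<le> (\<Sum>i\<in>I. real (card ((\<lambda>y. y N) ` cylinder (x i) (n i))))"
    by (simp add: u_def flip: of_nat_sum)
  also have "\<dots> = u N * (\<Sum>i\<in>I. 1 / u (n i))"
    using x N by (simp add: card_proj_cylinder sum_distrib_left)
  finally show ?thesis by simp
qed

lemma sum_disjoint_cylinders_le_1:
  assumes fin: "finite I" and x: "\<And>i. i \<in> I \<Longrightarrow> x i \<in> U"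
    and disj: "disjoint_family_on (\<lambda>i. cylinder (x i) (n i)) I"
  shows "(\<Sum>i\<in>I. 1 / u (n i)) \<le> 1"
proof -
  define N where "N = Max (n ` I)"
  have N: "n i \<le> N" if "i \<in> I" for i using fin that by (simp add: N_def)
  have "(\<Sum>i\<in>I. card ((\<lambda>y. y N) ` cylinder (x i) (n i)))
      = card (\<Union>i\<in>I. (\<lambda>y. y N) ` cylinder (x i) (n i))"
  proof (rule card_UN_disjoint[symmetric, OF fin])
    show "\<forall>i\<in>I. finite ((\<lambda>y. y N) ` cylinder (x i) (n i))"
      by (intro ballI finite_proj subset_trans[OF cylinder_subset U_subset])
    show "\<forall>i\<in>I. \<forall>j\<in>I. i \<noteq> j \<longrightarrow>
        (\<lambda>y. y N) ` cylinder (x i) (n i) \<inter> (\<lambda>y. y N) ` cylinder (x j) (n j) = {}"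
    proof (intro ballI impI equals0I)
      fix i j v assume ij: "i \<in> I" "j \<in> I" "i \<noteq> j"
        and "v \<in> (\<lambda>y. y N) ` cylinder (x i) (n i) \<inter> (\<lambda>y. y N) ` cylinder (x j) (n j)"
      then obtain y z where y: "y \<in> cylinder (x i) (n i)" and z: "z \<in> cylinder (x j) (n j)"
        and "y N = z N" by auto
      then have "y (n j) = z (n j)"
        using agree_le[of y z N "n j"] U_subset N ij by (auto simp: cylinder_def)
      then have "y \<in> cylinder (x j) (n j)" using y z by (simp add: cylinder_def)
      then show False using y disj ij by (auto simp: disjoint_family_on_def)
    qed
  qed
  also have "\<dots> \<le> card ((\<lambda>y. y N) ` U)"
    using cylinder_subset by (intro card_mono finite_proj[OF U_subset]) blast
  finally have "(\<Sum>i\<in>I. real (card ((\<lambda>y. y N) ` cylinder (x i) (n i)))) \<le> u N"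
    by (simp add: u_def flip: of_nat_sum)
  then have "u N * (\<Sum>i\<in>I. 1 / u (n i)) \<le> u N * 1"
    using x N by (simp add: card_proj_cylinder sum_distrib_left)
  then show ?thesis using u_pos by (simp only: mult_le_cancel_left_pos)
qed

section \<open>Topology\<close>

abbreviation T where "T \<equiv> product_topology (\<lambda>n. discrete_topology (carrier (L n))) UNIV"

lemma closedin_U: "closedin T U"
proof -
  have c: "continuous_map T (discrete_topology (carrier (L n))) (\<lambda>x. x n)" for n
    using continuous_map_product_projection[of n UNIV "\<lambda>n. discrete_topology (carrier (L n))"] by simp
  have cp: "continuous_map T (discrete_topology (carrier (L n))) (\<lambda>x. p n (x (Suc n)))" for n
    by (rule continuous_map_compose[OF c, unfolded comp_def])
      (use hom[of n] in \<open>auto simp: hom_def\<close>)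
  have "closedin T {x \<in> topspace T. p n (x (Suc n)) = x n}" for n
    by (rule closedin_continuous_maps_eq[OF _ cp c]) simp
  then have "closedin T (\<Inter>n. {x \<in> topspace T. p n (x (Suc n)) = x n})"
    by (intro closedin_Inter) auto
  moreover have "(\<Inter>n. {x \<in> topspace T. p n (x (Suc n)) = x n}) = G"
    by (auto simp: carrier_inverse_limit PiE_iff)
  ultimately show ?thesis
    using closed closedin_trans_full unfolding inverse_limit_topology_def by metis
qed

lemma compactin_U: "compactin T U"
  using closedin_U closedin_compact_space compact_space_product_topology finite_carrier
  by (metis compact_space_discrete_topology)

lemma openin_T_cylinder: "openin T {y \<in> topspace T. y n = a}"
proof -
  have "openin T {y \<in> topspace T. y n \<in> {a} \<inter> carrier (L n)}"
    by (rule openin_continuous_map_preimage[of _ "discrete_topology (carrier (L n))"])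
      (use continuous_map_product_projection[of n UNIV "\<lambda>n. discrete_topology (carrier (L n))"] in auto)
  then show ?thesis by (rule back_subst[of "openin T"]) (auto simp: PiE_iff)
qed

lemma U_subset_topspace: "U \<subseteq> topspace T"
  using closedin_U closedin_subset by blast

lemma openin_cylinder: "openin (subtopology T U) (cylinder x n)"
proof -
  have "cylinder x n = U \<inter> {y \<in> topspace T. y n = x n}"
    using U_subset_topspace by (auto simp: cylinder_def)
  then show ?thesis using openin_T_cylinder by (simp add: openin_subtopology_Int2)
qed

lemma openin_contains_cylinder:
  assumes "openin (subtopology T U) W" "x \<in> W"
  obtains n where "cylinder x n \<subseteq> W"
proof -
  obtain S where S: "openin T S" "W = S \<inter> U"
    using assms(1) by (auto simp: openin_subtopology)
  then obtain V where V: "finite {i. V i \<noteq> carrier (L i)}" "x \<in> Pi\<^sub>E UNIV V" "Pi\<^sub>E UNIV V \<subseteq> S"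
    using assms(2) by (auto simp: openin_product_topology_alt)
  obtain n where n: "{i. V i \<noteq> carrier (L i)} \<subseteq> {..n}"
    using V(1) finite_nat_iff_bounded_le by blast
  have "cylinder x n \<subseteq> W"
  proof
    fix y assume y: "y \<in> cylinder x n"
    have x: "x \<in> U" using assms(2) S by blast
    have "y i \<in> V i" for i
    proof (cases "i \<le> n")
      case True
      then have "y i = x i" using y x U_subset by (intro agree_le[of y x n i]) (auto simp: cylinder_def)
      then show ?thesis using V(2) by auto
    next
      case False
      then have "V i = carrier (L i)" using n by auto
      then show ?thesis using y U_subset in_carrier by (auto simp: cylinder_def)
    qed
    then show "y \<in> W" using V(3) S y by (auto simp: cylinder_def)
  qed
  then show ?thesis by (rule that)
qed

end

section \<open>Hausdorff and packing measures\<close>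

lemma small_covers_mono: "\<alpha> \<le> \<beta> \<Longrightarrow> small_covers M d \<alpha> X \<subseteq> small_covers M d \<beta> X"
  unfolding small_covers_def by (auto intro: order_trans ennreal_leI)

lemma small_packings_mono: "\<alpha> \<le> \<beta> \<Longrightarrow> small_packings M d \<alpha> X \<subseteq> small_packings M d \<beta> X"
  unfolding small_packings_def by fastforce

lemma hausdorff_measure_eq_SUP:
  "hausdorff_measure M d r X = (SUP \<alpha>\<in>{0<..}. INF C\<in>{C \<in> small_covers M d \<alpha> X. countable C}.
     (\<Sum>\<^sub>\<infinity>E\<in>C. diam_power (ediameter d E) r))"
  unfolding hausdorff_measure_def
  by (rule Lim_at_right_antimono, rule INF_superset_mono) (use small_covers_mono in blast)+

lemma packing_premeasure_eq_INF:
  "packing_premeasure M d r V = (INF \<alpha>\<in>{0<..}. SUP C\<in>small_packings M d \<alpha> V.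
     (\<Sum>\<^sub>\<infinity>(x, \<rho>)\<in>C. ennreal ((2 * \<rho>) powr r)))"
  unfolding packing_premeasure_def
  by (rule Lim_at_right_mono, rule SUP_subset_mono) (use small_packings_mono in blast)+

lemma hausdorff_measure_0_pos:
  assumes "X \<noteq> {}"
  shows "0 < hausdorff_measure M d 0 X"
proof -
  have "1 \<le> (\<Sum>\<^sub>\<infinity>E\<in>C. diam_power (ediameter d E) 0)" if C: "C \<in> small_covers M d 1 X" for C
  proof -
    obtain E where "E \<in> C" using C assms by (fastforce simp: small_covers_def)
    then show ?thesis
      using sum_le_infsum_ennreal[of "{E}" C "\<lambda>E. diam_power (ediameter d E) 0"]
      by (simp add: diam_power_def)
  qed
  then have "1 \<le> hausdorff_measure M d 0 X"
    unfolding hausdorff_measure_eq_SUP by (intro SUP_upper2[of 1] INF_greatest) auto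
  then show ?thesis using less_le_trans zero_less_one by blast
qed

lemma packing_measure_0_pos:
  assumes "X \<noteq> {}"
  shows "0 < packing_measure M d 0 X"
proof -
  have *: "1 \<le> packing_premeasure M d 0 V" if "x \<in> V" for x V
    unfolding packing_premeasure_eq_INF
  proof (intro INF_greatest SUP_upper2)
    fix \<alpha> :: real assume "\<alpha> \<in> {0<..}"
    then show "{(x, \<alpha> / 2)} \<in> small_packings M d \<alpha> V"
      using that by (auto simp: small_packings_def disjoint_family_on_def)
    show "1 \<le> (\<Sum>\<^sub>\<infinity>(x, \<rho>)\<in>{(x, \<alpha> / 2)}. ennreal ((2 * \<rho>) powr 0))"
      using \<open>\<alpha> \<in> {0<..}\<close> by simp
  qed
  have "1 \<le> packing_measure M d 0 X"
    unfolding packing_measure_def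
  proof (rule INF_greatest)
    fix \<V> assume "\<V> \<in> {\<V>. countable \<V> \<and> \<V> \<subseteq> Pow M \<and> X \<subseteq> \<Union>\<V>}"
    then have "X \<subseteq> \<Union>\<V>" by simp
    then obtain V x where "V \<in> \<V>" "x \<in> V" using assms by blast
    then show "1 \<le> (\<Sum>\<^sub>\<infinity>V\<in>\<V>. packing_premeasure M d 0 V)"
      using *[of x V] sum_le_infsum_ennreal[of "{V}" \<V> "packing_premeasure M d 0"]
      by (auto intro: order_trans)
  qed
  then show ?thesis using less_le_trans zero_less_one by blast
qed

lemma ediameter_le_iff:
  "0 \<le> \<alpha> \<Longrightarrow> ediameter d E \<le> ennreal \<alpha> \<longleftrightarrow> (\<forall>x\<in>E. \<forall>y\<in>E. d x y \<le> \<alpha>)"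
  by (simp add: ediameter_def SUP_le_iff ennreal_le_iff)

lemma diam_power_le:
  assumes "0 < r" "0 \<le> \<alpha>" "ediameter d E \<le> ennreal \<alpha>"
  shows "diam_power (ediameter d E) r \<le> ennreal (\<alpha> powr r)"
proof -
  have "enn2real (ediameter d E) \<le> \<alpha>"
    using assms by (simp add: enn2real_leI)
  then show ?thesis using assms by (auto simp: diam_power_def intro!: ennreal_leI powr_mono2)
qed

lemma le_diam_power:
  assumes "0 < r" "0 \<le> d x y" "x \<in> E" "y \<in> E" "ediameter d E < \<infinity>"
  shows "ennreal (d x y powr r) \<le> diam_power (ediameter d E) r"
proof -
  have "ennreal (d x y) \<le> ediameter d E"
    unfolding ediameter_def using assms by (intro SUP_upper2[of x] SUP_upper2[of y]) auto
  then have "d x y \<le> enn2real (ediameter d E)"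
    using assms enn2real_mono[of "ennreal (d x y)" "ediameter d E"] by simp
  then show ?thesis using assms by (auto simp: diam_power_def intro!: ennreal_leI powr_mono2)
qed

context closed_subgroup_inverse_limit
begin

lemma tendsto_l_powr_neg: "s < 0 \<Longrightarrow> (\<lambda>n. l n powr s) \<longlonglongrightarrow> 0"
  by (rule tendsto_neg_powr[OF _ filterlim_l])

lemma ex_inverse_l_le:
  assumes "0 < \<alpha>"
  obtains n where "1 / l n \<le> \<alpha>"
proof -
  have "\<forall>\<^sub>F n in sequentially. 1 / \<alpha> \<le> l n"
    using filterlim_l by (simp add: filterlim_at_top)
  then obtain n where "1 / \<alpha> \<le> l n" by (auto simp: eventually_sequentially)
  then have "1 / l n \<le> \<alpha>" using assms by (simp add: field_simps)
  then show ?thesis by (rule that)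
qed

lemma eventually_inverse_l_le: "0 < \<alpha> \<Longrightarrow> \<forall>\<^sub>F n in sequentially. 1 / l n \<le> \<alpha>"
proof -
  assume "0 < \<alpha>"
  then obtain m where m: "1 / l m \<le> \<alpha>" by (rule ex_inverse_l_le)
  have "1 / l n \<le> 1 / l m" if "m \<le> n" for n
    using l_mono[OF that] by (intro divide_left_mono) auto
  then show ?thesis using m unfolding eventually_sequentially by (meson order_trans)
qed

definition cylinders :: "nat \<Rightarrow> (nat \<Rightarrow> 'a) set set" where
  "cylinders n = (\<lambda>a. {y \<in> U. y n = a}) ` (\<lambda>x. x n) ` U"

lemma finite_cylinders: "finite (cylinders n)"
  unfolding cylinders_def using finite_proj[OF U_subset] by blast

lemma card_cylinders_le: "card (cylinders n) \<le> card ((\<lambda>x. x n) ` U)"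
  unfolding cylinders_def using finite_proj[OF U_subset] by (rule card_image_le)

lemma ediameter_cylinder_le: "E \<in> cylinders n \<Longrightarrow> ediameter d E \<le> ennreal (1 / l n)"
  using U_subset by (auto simp: cylinders_def ediameter_le_iff less_imp_le dist_le_iff_agree subset_iff)

lemma cylinders_in_small_covers:
  assumes "1 / l n \<le> \<alpha>"
  shows "cylinders n \<in> small_covers G d \<alpha> U"
  using U_subset order_trans[OF ediameter_cylinder_le ennreal_leI[OF assms]]
  by (fastforce simp: small_covers_def cylinders_def)

lemma hausdorff_measure_eq_0:
  assumes "s < r" "0 < r" and freq: "\<exists>\<^sub>F n in sequentially. u n \<le> l n powr s"
  shows "hausdorff_measure G d r U = 0"
proof -
  have "(INF C\<in>{C \<in> small_covers G d \<alpha> U. countable C}.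
      (\<Sum>\<^sub>\<infinity>E\<in>C. diam_power (ediameter d E) r)) \<le> 0 + ennreal e" (is "?I \<le> _")
    if "0 < \<alpha>" "0 < e" for \<alpha> e
  proof -
    have "\<forall>\<^sub>F n in sequentially. l n powr (s - r) < e"
      using tendsto_l_powr_neg[of "s - r"] assms that by (simp add: order_tendsto_iff)
    then have "\<exists>\<^sub>F n in sequentially. u n \<le> l n powr s \<and> l n powr (s - r) < e \<and> 1 / l n \<le> \<alpha>"
      using freq eventually_inverse_l_le[OF \<open>0 < \<alpha>\<close>]
      by (simp add: frequently_eventually_frequently eventually_conj)
    then obtain n where n: "u n \<le> l n powr s" "l n powr (s - r) < e" "1 / l n \<le> \<alpha>"
      by (auto dest: frequently_ex)
    have "?I \<le> (\<Sum>\<^sub>\<infinity>E\<in>cylinders n. diam_power (ediameter d E) r)"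
      using cylinders_in_small_covers[OF n(3)] finite_cylinders countable_finite
      by (intro INF_lower) auto
    also have "\<dots> = (\<Sum>E\<in>cylinders n. diam_power (ediameter d E) r)"
      using finite_cylinders by simp
    also have "\<dots> \<le> (\<Sum>E\<in>cylinders n. ennreal ((1 / l n) powr r))"
      using assms ediameter_cylinder_le by (intro sum_mono diam_power_le) (auto simp: less_imp_le)
    also have "\<dots> = ennreal (real (card (cylinders n)) * (1 / l n) powr r)"
      by (simp add: ennreal_mult ennreal_of_nat_eq_real_of_nat)
    also have "\<dots> \<le> ennreal (l n powr s * (1 / l n) powr r)"
      using n(1) card_cylinders_le[of n]
      by (intro ennreal_leI mult_right_mono) (auto simp: u_def)
    also have "l n powr s * (1 / l n) powr r = l n powr (s - r)"
      by (simp add: powr_diff powr_divide)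
    also have "ennreal \<dots> \<le> 0 + ennreal e" using n(2) by (simp add: ennreal_leI)
    finally show ?thesis .
  qed
  then have "(INF C\<in>{C \<in> small_covers G d \<alpha> U. countable C}.
      (\<Sum>\<^sub>\<infinity>E\<in>C. diam_power (ediameter d E) r)) \<le> 0" if "0 < \<alpha>" for \<alpha>
    using that by (rule_tac ennreal_le_epsilon)
  then have "hausdorff_measure G d r U \<le> 0"
    unfolding hausdorff_measure_eq_SUP by (intro SUP_least) auto
  then show ?thesis by simp
qed

text \<open>
  If \<open>E\<close> is not a singleton, it has two points at distance exactly \<open>1 / l n\<close>, where \<open>n\<close> is the
  last level at which \<open>E\<close> projects to one point; otherwise \<open>n\<close> may be arbitrarily large.
\<close>

lemma ex_level_le_diam_power:
  assumes "0 < s" and ev: "\<And>n. N \<le> n \<Longrightarrow> l n powr s \<le> u n"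
    and E: "E \<subseteq> G" "ediameter d E \<le> ennreal (1 / l N)" and "0 < e"
  shows "\<exists>n. (\<forall>x\<in>E. \<forall>y\<in>E. x n = y n) \<and> ennreal (1 / u n) \<le> diam_power (ediameter d E) s + ennreal e"
proof (cases "\<forall>n\<ge>N. \<forall>x\<in>E. \<forall>y\<in>E. x n = y n")
  case True
  have "\<forall>\<^sub>F n in sequentially. N \<le> n \<and> l n powr - s < e"
    using tendsto_l_powr_neg[of "- s"] \<open>0 < s\<close> \<open>0 < e\<close> eventually_ge_at_top[of N]
    by (simp add: order_tendsto_iff eventually_conj)
  then obtain n where n: "N \<le> n" "l n powr - s < e"
    by (auto dest: eventually_happens'[OF sequentially_bot])
  have "1 / u n \<le> 1 / l n powr s" using ev[OF n(1)] by (intro divide_left_mono mult_pos_pos) auto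
  then have "1 / u n \<le> e" using n(2) by (simp add: powr_minus_divide)
  then have "ennreal (1 / u n) \<le> diam_power (ediameter d E) s + ennreal e"
    by (intro add_increasing ennreal_leI) auto
  then show ?thesis using True n(1) by blast
next
  case False
  let ?P = "\<lambda>n. \<forall>x\<in>E. \<forall>y\<in>E. x n = y n"
  obtain m where m: "N \<le> m" "\<not> ?P m" using False by blast
  have PN: "?P N"
    using E by (auto simp: ediameter_le_iff less_imp_le dist_le_iff_agree subset_iff)
  obtain n where n: "N \<le> n" "?P n" "\<not> ?P (Suc n)"
    using dec_induct[of N m ?P] m PN by blast
  then obtain x y where xy: "x \<in> E" "y \<in> E" "x n = y n" "x (Suc n) \<noteq> y (Suc n)" by blast
  then have "d x y = 1 / l n" using E by (intro dist_eq) auto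
  then have "ennreal ((1 / l n) powr s) \<le> diam_power (ediameter d E) s"
    using le_diam_power[of s d x y E] xy \<open>0 < s\<close> E(2)
    by (simp add: less_imp_le le_less_trans[OF E(2)])
  moreover have "1 / u n \<le> (1 / l n) powr s"
    using ev[OF n(1)] by (simp add: powr_divide frac_le)
  ultimately have "ennreal (1 / u n) \<le> diam_power (ediameter d E) s"
    by (meson ennreal_leI order_trans)
  then show ?thesis using n(2) by (meson add_increasing2 zero_le)
qed

lemma hausdorff_measure_pos:
  assumes "0 < s" and "\<forall>\<^sub>F n in sequentially. l n powr s \<le> u n"
  shows "0 < hausdorff_measure G d s U"
proof -
  obtain N where N: "\<And>n. N \<le> n \<Longrightarrow> l n powr s \<le> u n"
    using assms(2) by (auto simp: eventually_sequentially)
  have "1 \<le> (\<Sum>\<^sub>\<infinity>E\<in>C. diam_power (ediameter d E) s) + ennreal \<epsilon>"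
    if C: "C \<in> small_covers G d (1 / l N) U" "countable C" and "0 < \<epsilon>" for C \<epsilon>
  proof -
    define e where "e E = \<epsilon> * (1/2) ^ Suc (to_nat_on C E)" for E
    define C' where "C' = {E \<in> C. E \<inter> U \<noteq> {}}"
    have "\<exists>n. (\<forall>x\<in>E. \<forall>y\<in>E. x n = y n) \<and>
        ennreal (1 / u n) \<le> diam_power (ediameter d E) s + ennreal (e E)" if "E \<in> C'" for E
      using that C \<open>0 < \<epsilon>\<close>
      by (intro ex_level_le_diam_power[OF assms(1) N]) (auto simp: e_def C'_def small_covers_def)
    then obtain n where n: "\<And>E x y. E \<in> C' \<Longrightarrow> x \<in> E \<Longrightarrow> y \<in> E \<Longrightarrow> x (n E) = y (n E)"
      "\<And>E. E \<in> C' \<Longrightarrow> ennreal (1 / u (n E)) \<le> diam_power (ediameter d E) s + ennreal (e E)"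
      by metis
    have "\<exists>z. z \<in> E \<and> z \<in> U" if "E \<in> C'" for E using that by (auto simp: C'_def)
    then obtain x where x: "\<And>E. E \<in> C' \<Longrightarrow> x E \<in> E \<and> x E \<in> U" by metis
    define W where "W E = {y \<in> topspace T. y (n E) = x E (n E)}" for E
    have "U \<subseteq> \<Union> (W ` C')"
    proof
      fix y assume y: "y \<in> U"
      then obtain E where "E \<in> C" "y \<in> E" using C by (auto simp: small_covers_def)
      then have "E \<in> C'" using y by (auto simp: C'_def)
      then show "y \<in> \<Union> (W ` C')"
        using n(1)[of E y "x E"] x[of E] \<open>y \<in> E\<close> y U_subset_topspace by (auto simp: W_def)
    qed
    moreover have "\<forall>S\<in>W ` C'. openin T S" using openin_T_cylinder by (auto simp: W_def)
    ultimately obtain \<F> where "finite \<F>" "\<F> \<subseteq> W ` C'" "U \<subseteq> \<Union>\<F>"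
      using compactin_U unfolding compactin_def by meson
    then obtain F where F: "finite F" "F \<subseteq> C'" "U \<subseteq> \<Union> (W ` F)"
      by (metis finite_subset_image)
    have "1 \<le> (\<Sum>E\<in>F. 1 / u (n E))"
      using F x by (intro sum_cylinder_cover_ge_1[of F x n]) (auto simp: cylinder_def W_def)
    then have "1 \<le> ennreal (\<Sum>E\<in>F. 1 / u (n E))" by (simp add: ennreal_1[symmetric] del: ennreal_1)
    also have "\<dots> = (\<Sum>E\<in>F. ennreal (1 / u (n E)))" by (simp add: sum_ennreal less_imp_le)
    also have "\<dots> \<le> (\<Sum>E\<in>F. diam_power (ediameter d E) s + ennreal (e E))"
      using n(2) F by (intro sum_mono) auto
    also have "\<dots> = (\<Sum>E\<in>F. diam_power (ediameter d E) s) + ennreal (\<Sum>E\<in>F. e E)"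
      using \<open>0 < \<epsilon>\<close> by (simp add: sum.distrib sum_ennreal e_def)
    also have "\<dots> \<le> (\<Sum>\<^sub>\<infinity>E\<in>C. diam_power (ediameter d E) s) + ennreal \<epsilon>"
    proof (intro add_mono ennreal_leI)
      have "F \<subseteq> C" using F by (auto simp: C'_def)
      then show "(\<Sum>E\<in>F. diam_power (ediameter d E) s) \<le> (\<Sum>\<^sub>\<infinity>E\<in>C. diam_power (ediameter d E) s)"
        using F by (intro sum_le_infsum_ennreal)
      show "(\<Sum>E\<in>F. e E) \<le> \<epsilon>"
        using mult_left_mono[OF sum_geometric_to_nat_on_le[OF C(2) F(1) \<open>F \<subseteq> C\<close>], of \<epsilon>] \<open>0 < \<epsilon>\<close>
        by (simp add: e_def sum_distrib_left)
    qed
    finally show ?thesis .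
  qed
  then have "1 \<le> (\<Sum>\<^sub>\<infinity>E\<in>C. diam_power (ediameter d E) s)"
    if "C \<in> small_covers G d (1 / l N) U" "countable C" for C
    using that by (rule_tac ennreal_le_epsilon)
  then have "1 \<le> hausdorff_measure G d s U"
    unfolding hausdorff_measure_eq_SUP by (intro SUP_upper2[of "1 / l N"] INF_greatest) auto
  then show ?thesis using less_le_trans zero_less_one by blast
qed

lemma ex_ball_level:
  assumes "0 < \<rho>"
  obtains n where "1 / l n < \<rho>" "n = 0 \<or> \<rho> \<le> 1 / l (n - 1)"
proof -
  obtain m where "1 / l m \<le> \<rho> / 2" using ex_inverse_l_le[of "\<rho> / 2"] assms by auto
  then have ex: "1 / l m < \<rho>" using assms by linarith
  define n where "n = (LEAST n. 1 / l n < \<rho>)"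
  have "1 / l n < \<rho>" unfolding n_def by (rule LeastI[of _ m]) (rule ex)
  moreover have "\<rho> \<le> 1 / l (n - 1)" if "n \<noteq> 0"
    using not_less_Least[of "n - 1" "\<lambda>n. 1 / l n < \<rho>"] that unfolding n_def[symmetric] by simp
  ultimately show ?thesis by (intro that[of n]) auto
qed

lemma sum_packing_le:
  assumes "s < r" and N: "\<And>n. N < n \<Longrightarrow> u n \<le> l (n - 1) powr s"
    and C: "C \<in> small_packings G d (1 / l N) U" and F: "finite F" "F \<subseteq> C" and "0 \<le> r"
  shows "(\<Sum>(x, \<rho>)\<in>F. (2 * \<rho>) powr r) \<le> 2 powr r * l N powr (s - r)"
proof -
  have "\<exists>n. 1 / l n < \<rho> \<and> (n = 0 \<or> \<rho> \<le> 1 / l (n - 1))" if "0 < \<rho>" for \<rho>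
    using ex_ball_level[OF that] by blast
  then obtain m where m: "\<And>\<rho>. 0 < \<rho> \<Longrightarrow> 1 / l (m \<rho>) < \<rho> \<and> (m \<rho> = 0 \<or> \<rho> \<le> 1 / l (m \<rho> - 1))"
    by metis
  have Cx: "x \<in> U" "0 < \<rho>" "2 * \<rho> \<le> 1 / l N" if "(x, \<rho>) \<in> F" for x \<rho>
    using that C F by (auto simp: small_packings_def)
  have disj: "disjoint_family_on (\<lambda>(x, \<rho>). mball x \<rho>) F"
    using C F(2) by (auto simp: small_packings_def intro: disjoint_family_on_mono)
  have ball: "cylinder x (m \<rho>) \<subseteq> mball x \<rho>" if "(x, \<rho>) \<in> F" for x \<rho>
    using Cx[OF that] m[of \<rho>] U_subset dist_less_iff[of x _ "m \<rho>" \<rho>]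
    by (auto simp: cylinder_def subset_iff)
  have "(2 * \<rho>) powr r \<le> 2 powr r * l N powr (s - r) * (1 / u (m \<rho>))" if F': "(x, \<rho>) \<in> F" for x \<rho>
  proof -
    define k where "k = m \<rho> - 1"
    have "1 / l (m \<rho>) < 1 / l N" using m[of \<rho>] Cx[OF F'] by linarith
    then have "l N < l (m \<rho>)" by (simp add: field_simps)
    then have mN: "N < m \<rho>" using l_mono[of "m \<rho>" N] by fastforce
    then have \<rho>: "\<rho> \<le> 1 / l k" "N \<le> k" using m[of \<rho>] Cx[OF F'] by (auto simp: k_def)
    have "(2 * \<rho>) powr r \<le> (2 * (1 / l k)) powr r"
      using \<rho> Cx[OF F'] \<open>0 \<le> r\<close> by (intro powr_mono2) auto
    also have "\<dots> = 2 powr r * l k powr (s - r) * (1 / l k powr s)"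
      using l_pos[of k] by (simp add: powr_divide powr_diff del: l_pos)
    also have "\<dots> \<le> 2 powr r * l N powr (s - r) * (1 / u (m \<rho>))"
    proof (intro mult_mono mult_left_mono)
      show "l k powr (s - r) \<le> l N powr (s - r)"
        using l_mono[OF \<rho>(2)] assms(1) by (intro powr_mono2') auto
      show "1 / l k powr s \<le> 1 / u (m \<rho>)"
        using N[OF mN] by (intro divide_left_mono mult_pos_pos) (auto simp: k_def)
    qed auto
    finally show ?thesis .
  qed
  then have "(\<Sum>(x, \<rho>)\<in>F. (2 * \<rho>) powr r)
      \<le> (\<Sum>i\<in>F. 2 powr r * l N powr (s - r) * (1 / u (m (snd i))))"
    by (intro sum_mono) auto
  also have "\<dots> = 2 powr r * l N powr (s - r) * (\<Sum>i\<in>F. 1 / u (m (snd i)))"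
    by (simp add: sum_distrib_left)
  also have "(\<Sum>i\<in>F. 1 / u (m (snd i))) \<le> 1"
  proof (rule sum_disjoint_cylinders_le_1[OF F(1), where x = fst])
    show "disjoint_family_on (\<lambda>i. cylinder (fst i) (m (snd i))) F"
      using disj ball unfolding disjoint_family_on_def by fastforce
  qed (use Cx in auto)
  then have "2 powr r * l N powr (s - r) * (\<Sum>i\<in>F. 1 / u (m (snd i))) \<le> 2 powr r * l N powr (s - r)"
    by (intro mult_right_le_one_le) (auto intro!: sum_nonneg simp: less_imp_le)
  finally show ?thesis .
qed

lemma packing_measure_eq_0:
  assumes "s < r" "0 \<le> r" and ev: "\<forall>\<^sub>F n in sequentially. u n \<le> l (n - 1) powr s"
  shows "packing_measure G d r U = 0"
proof -
  obtain N0 where N0: "\<And>n. N0 \<le> n \<Longrightarrow> u n \<le> l (n - 1) powr s"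
    using ev by (auto simp: eventually_sequentially)
  have "packing_premeasure G d r U \<le> 0 + ennreal e" if "0 < e" for e
  proof -
    have "(\<lambda>n. 2 powr r * l n powr (s - r)) \<longlonglongrightarrow> 2 powr r * 0"
      using assms(1) by (intro tendsto_mult tendsto_const tendsto_l_powr_neg) simp
    then have "\<forall>\<^sub>F n in sequentially. N0 \<le> n \<and> 2 powr r * l n powr (s - r) < e"
      using that eventually_ge_at_top[of N0] by (simp add: order_tendsto_iff eventually_conj)
    then obtain N where N: "N0 \<le> N" "2 powr r * l N powr (s - r) < e"
      by (auto dest: eventually_happens'[OF sequentially_bot])
    have "(\<Sum>\<^sub>\<infinity>(x, \<rho>)\<in>C. ennreal ((2 * \<rho>) powr r)) \<le> ennreal e"
      if C: "C \<in> small_packings G d (1 / l N) U" for C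
    proof (rule infsum_le_ennreal)
      fix F assume F: "finite F" "F \<subseteq> C"
      have "(\<Sum>(x, \<rho>)\<in>F. ennreal ((2 * \<rho>) powr r)) = ennreal (\<Sum>(x, \<rho>)\<in>F. (2 * \<rho>) powr r)"
        by (subst sum_ennreal[symmetric]) (auto simp: case_prod_beta)
      also have "\<dots> \<le> ennreal e"
        using sum_packing_le[OF assms(1) _ C F assms(2)] N N0 by (intro ennreal_leI) force
      finally show "(\<Sum>(x, \<rho>)\<in>F. ennreal ((2 * \<rho>) powr r)) \<le> ennreal e" .
    qed
    then show ?thesis
      unfolding packing_premeasure_eq_INF by (intro INF_lower2[of "1 / l N"] SUP_least) auto
  qed
  then have "packing_premeasure G d r U \<le> 0" by (rule ennreal_le_epsilon)
  then have "packing_premeasure G d r U = 0" by simp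
  moreover have "packing_measure G d r U \<le> (\<Sum>\<^sub>\<infinity>V\<in>{U}. packing_premeasure G d r V)"
    unfolding packing_measure_def using U_subset by (intro INF_lower) auto
  ultimately show ?thesis by simp
qed

lemma ex_somewhere_dense:
  assumes "countable \<V>" "U \<subseteq> \<Union>\<V>"
  obtains V x m where "V \<in> \<V>" "x \<in> U" "\<And>y n. y \<in> cylinder x m \<Longrightarrow> \<exists>v\<in>V \<inter> U. v n = y n"
proof -
  let ?X = "subtopology T U"
  have top: "topspace ?X = U" using U_subset_topspace by auto
  have "compact_space ?X" using compactin_U by (rule compact_space_subtopology)
  moreover have "Hausdorff_space ?X"
    by (intro Hausdorff_space_subtopology) (simp add: Hausdorff_space_product_topology)
  ultimately have lc: "locally_compact_space ?X \<and> regular_space ?X"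
    using compact_imp_locally_compact_space compact_Hausdorff_imp_regular_space by blast
  have "\<exists>S\<in>(\<lambda>V. ?X closure_of (V \<inter> U)) ` \<V>. ?X interior_of S \<noteq> {}"
  proof (rule ccontr)
    assume "\<not> ?thesis"
    then have "?X interior_of \<Union> ((\<lambda>V. ?X closure_of (V \<inter> U)) ` \<V>) = {}"
      using assms(1) lc by (intro Baire_category_alt) auto
    moreover have "U \<subseteq> \<Union> ((\<lambda>V. ?X closure_of (V \<inter> U)) ` \<V>)"
    proof
      fix y assume "y \<in> U"
      then obtain V where V: "V \<in> \<V>" "y \<in> V \<inter> U" using assms(2) by blast
      then have "y \<in> ?X closure_of (V \<inter> U)"
        using closure_of_subset[of "V \<inter> U" ?X] top by blast
      then show "y \<in> \<Union> ((\<lambda>V. ?X closure_of (V \<inter> U)) ` \<V>)" using V(1) by blast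
    qed
    then have "U \<subseteq> ?X interior_of \<Union> ((\<lambda>V. ?X closure_of (V \<inter> U)) ` \<V>)"
      using interior_of_mono interior_of_topspace top by metis
    ultimately show False using U_nonempty by blast
  qed
  then obtain V x where V: "V \<in> \<V>" and x: "x \<in> ?X interior_of (?X closure_of (V \<inter> U))" by blast
  obtain m where m: "cylinder x m \<subseteq> ?X interior_of (?X closure_of (V \<inter> U))"
    using openin_contains_cylinder[OF openin_interior_of x] by blast
  show ?thesis
  proof (rule that[OF V])
    show "x \<in> U" using x interior_of_subset_topspace[of ?X] top by blast
    fix y n assume y: "y \<in> cylinder x m"
    then have cl: "y \<in> ?X closure_of (V \<inter> U)" using m interior_of_subset[of ?X] by blast
    have "y \<in> cylinder y n" using y by (intro mem_cylinder) (auto simp: cylinder_def)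
    then obtain v where "v \<in> V \<inter> U" "v \<in> cylinder y n"
      using cl openin_cylinder[of y n] unfolding in_closure_of by blast
    then show "\<exists>v\<in>V \<inter> U. v n = y n" by (auto simp: cylinder_def)
  qed
qed

lemma packing_measure_pos:
  assumes "s < t" "0 \<le> s" and freq: "\<exists>\<^sub>F n in sequentially. l (n - 1) powr t \<le> u n"
  shows "0 < packing_measure G d s U"
proof -
  have "\<infinity> \<le> packing_measure G d s U"
    unfolding packing_measure_def
  proof (rule INF_greatest)
    fix \<V> assume "\<V> \<in> {\<V>. countable \<V> \<and> \<V> \<subseteq> Pow G \<and> U \<subseteq> \<Union>\<V>}"
    then have "countable \<V>" "U \<subseteq> \<Union>\<V>" by auto
    then obtain V x m where V: "V \<in> \<V>" and x: "x \<in> U"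
      and dense: "\<And>y n. y \<in> cylinder x m \<Longrightarrow> \<exists>v\<in>V \<inter> U. v n = y n"
      by (rule ex_somewhere_dense) blast
    have "ennreal K \<le> (SUP C\<in>small_packings G d \<alpha> V. (\<Sum>\<^sub>\<infinity>(x, \<rho>)\<in>C. ennreal ((2 * \<rho>) powr s)))"
      if "0 < \<alpha>" for K \<alpha>
    proof -
      have "filterlim (\<lambda>n. l n powr (t - s)) at_top sequentially"
        using assms(1) by (intro filterlim_compose[OF real_powr_at_top filterlim_l]) simp
      then have "\<forall>\<^sub>F n in sequentially. u m * K \<le> l n powr (t - s)"
        by (simp add: filterlim_at_top)
      then have "\<forall>\<^sub>F n in sequentially. u m * K \<le> l n powr (t - s) \<and> 1 / l n \<le> \<alpha> / 2"
        using eventually_inverse_l_le[of "\<alpha> / 2"] that by (simp add: eventually_conj)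
      then have "\<forall>\<^sub>F n in sequentially. u m * K \<le> l (n - 1) powr (t - s) \<and> 1 / l (n - 1) \<le> \<alpha> / 2"
        by (rule eventually_compose_filterlim[OF _ filterlim_minus_const_nat_at_top])
      then have "\<exists>\<^sub>F n in sequentially. l (n - 1) powr t \<le> u n \<and>
          ((u m * K \<le> l (n - 1) powr (t - s) \<and> 1 / l (n - 1) \<le> \<alpha> / 2) \<and> m \<le> n \<and> 1 \<le> n)"
        using freq eventually_ge_at_top[of m] eventually_ge_at_top[of 1]
        by (intro frequently_eventually_frequently) (simp_all add: eventually_conj_iff)
      then obtain n where n: "l (n - 1) powr t \<le> u n" "u m * K \<le> l (n - 1) powr (t - s)"
        "1 / l (n - 1) \<le> \<alpha> / 2" "m \<le> n" "1 \<le> n" by (auto dest: frequently_ex)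
      define A where "A = (\<lambda>y. y n) ` cylinder x m"
      have finA: "finite A"
        unfolding A_def using cylinder_subset U_subset by (intro finite_proj) blast
      have "\<exists>v. v \<in> V \<inter> U \<and> v n = a" if "a \<in> A" for a
        using that dense unfolding A_def by fastforce
      then obtain v where v: "\<And>a. a \<in> A \<Longrightarrow> v a \<in> V \<inter> U \<and> v a n = a" by metis
      define \<rho> where "\<rho> = 1 / l (n - 1)"
      define C where "C = (\<lambda>a. (v a, \<rho>)) ` A"
      have \<rho>: "0 < \<rho>" "1 / l n < \<rho>"
        unfolding \<rho>_def using l_less[of "n - 1"] n(5) by (auto intro!: divide_strict_left_mono)
      have "C \<in> small_packings G d \<alpha> V"
        unfolding small_packings_def
      proof (intro CollectI conjI)
        show "countable C" unfolding C_def using finA by (simp add: countable_finite)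
        show "\<forall>(x, \<rho>)\<in>C. x \<in> V \<and> 0 < \<rho> \<and> 2 * \<rho> \<le> \<alpha>"
          using v \<rho> n(3) by (auto simp: C_def \<rho>_def)
        have "a = b" if "a \<in> A" "b \<in> A" "y \<in> mball (v a) \<rho>" "y \<in> mball (v b) \<rho>" for a b y
          using that v U_subset dist_less_iff[of _ y n \<rho>] \<rho>
          by (auto simp: \<rho>_def)
        then show "disjoint_family_on (\<lambda>(x, \<rho>). mball x \<rho>) C"
          by (fastforce simp: C_def disjoint_family_on_def)
      qed
      moreover have "ennreal K \<le> (\<Sum>\<^sub>\<infinity>(x, \<rho>)\<in>C. ennreal ((2 * \<rho>) powr s))"
      proof -
        have "inj_on (\<lambda>a. (v a, \<rho>)) A" using v by (intro inj_on_inverseI[where g = "\<lambda>(w, _). w n"]) simp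
        then have "(\<Sum>\<^sub>\<infinity>(x, \<rho>)\<in>C. ennreal ((2 * \<rho>) powr s)) = (\<Sum>a\<in>A. ennreal ((2 * \<rho>) powr s))"
          using finA by (simp add: C_def sum.reindex)
        also have "\<dots> = ennreal (u n / u m * (2 * \<rho>) powr s)"
          using card_proj_cylinder[OF x n(4)]
          by (simp add: A_def ennreal_of_nat_eq_real_of_nat flip: ennreal_mult'')
        also have "\<dots> \<ge> ennreal K"
        proof (rule ennreal_leI)
          have "K \<le> l (n - 1) powr (t - s) / u m" using n(2) by (simp add: field_simps)
          also have "\<dots> = l (n - 1) powr t / u m * \<rho> powr s"
            by (simp add: \<rho>_def powr_diff powr_divide)
          also have "\<dots> \<le> u n / u m * (2 * \<rho>) powr s"
            using n(1) \<rho> assms(2) by (intro mult_mono divide_right_mono powr_mono2) (auto simp: less_imp_le)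
          finally show "K \<le> u n / u m * (2 * \<rho>) powr s" .
        qed
        finally show ?thesis .
      qed
      ultimately show ?thesis by (rule SUP_upper2)
    qed
    then have K: "ennreal K \<le> packing_premeasure G d s V" for K
      unfolding packing_premeasure_eq_INF by (intro INF_greatest) auto
    have "packing_premeasure G d s V = \<infinity>"
    proof (cases "packing_premeasure G d s V" rule: ennreal_cases)
      case (real r)
      then show ?thesis using K[of "r + 1"] by (simp add: ennreal_le_iff)
    qed simp
    then show "\<infinity> \<le> (\<Sum>\<^sub>\<infinity>V\<in>\<V>. packing_premeasure G d s V)"
      using sum_le_infsum_ennreal[of "{V}" \<V> "packing_premeasure G d s"] V by simp
  qed
  then show ?thesis by (simp add: top.extremum_unique)
qed

end

section \<open>Box dimensions\<close>

lemma Liminf_le_Liminf_compose: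
  fixes f :: "'a \<Rightarrow> 'b :: complete_linorder"
  assumes "filterlim g F H"
  shows "Liminf F f \<le> Liminf H (\<lambda>x. f (g x))"
  unfolding le_Liminf_iff using eventually_compose_filterlim[OF less_LiminfD assms] by blast

lemma Limsup_compose_le_Limsup:
  fixes f :: "'a \<Rightarrow> 'b :: complete_linorder"
  assumes "filterlim g F H"
  shows "Limsup H (\<lambda>x. f (g x)) \<le> Limsup F f"
  unfolding Limsup_le_iff using eventually_compose_filterlim[OF Limsup_lessD assms] by blast

lemma Sup_ereal_threshold:
  fixes A :: ereal
  assumes "0 \<le> A" and P0: "P 0"
    and P: "\<And>r. 0 < r \<Longrightarrow> ereal r < A \<Longrightarrow> P r"
    and notP: "\<And>r. 0 < r \<Longrightarrow> A < ereal r \<Longrightarrow> \<not> P r"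
  shows "Sup {ereal r | r. 0 \<le> r \<and> P r} = A"
proof (rule antisym)
  show "Sup {ereal r | r. 0 \<le> r \<and> P r} \<le> A"
  proof (rule Sup_least, clarify)
    fix r :: real assume "0 \<le> r" "P r"
    then show "ereal r \<le> A" using notP[of r] \<open>0 \<le> A\<close> by (cases "r = 0") (auto simp: zero_ereal_def not_less[symmetric])
  qed
  show "A \<le> Sup {ereal r | r. 0 \<le> r \<and> P r}"
    unfolding le_Sup_iff
  proof (intro allI impI)
    fix y assume "y < A"
    then obtain r where r: "y < ereal r" "ereal r < A" using ereal_dense2 by blast
    show "\<exists>x\<in>{ereal r | r. 0 \<le> r \<and> P r}. y < x"
    proof (cases "0 < r")
      case True
      then show ?thesis using r P[of r] by (intro bexI[of _ "ereal r"]) auto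
    next
      case False
      then have "y < ereal 0" using r(1) less_le_trans[of y "ereal r" "ereal 0"] by simp
      then show ?thesis using P0 by (intro bexI[of _ "ereal 0"]) auto
    qed
  qed
qed

lemma ln_ratio_le_iff:
  fixes x y s :: real
  shows "1 < x \<Longrightarrow> 0 < y \<Longrightarrow> ln y / ln x \<le> s \<longleftrightarrow> y \<le> x powr s"
  using log_le_iff[of x y s] by (simp add: log_def)

lemma le_ln_ratio_iff:
  fixes x y s :: real
  shows "1 < x \<Longrightarrow> 0 < y \<Longrightarrow> s \<le> ln y / ln x \<longleftrightarrow> x powr s \<le> y"
  using le_log_iff[of x y s] by (simp add: log_def)

context closed_subgroup_inverse_limit
begin

lemma covering_number_eq:
  assumes "1 / l n \<le> \<alpha>" "n = 0 \<or> \<alpha> < 1 / l (n - 1)"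
  shows "covering_number G d \<alpha> U = enat (card ((\<lambda>x. x n) ` U))"
proof (rule antisym)
  have "covering_number G d \<alpha> U \<le> enat (card (cylinders n))"
    unfolding covering_number_def
    using cylinders_in_small_covers[OF assms(1)] finite_cylinders
    by (intro INF_lower2[of "cylinders n"]) auto
  also have "\<dots> \<le> enat (card ((\<lambda>x. x n) ` U))" using card_cylinders_le by simp
  finally show "covering_number G d \<alpha> U \<le> enat (card ((\<lambda>x. x n) ` U))" .
  have "0 < \<alpha>" using assms(1) l_pos[of n] by (smt (verit) divide_pos_pos)
  show "enat (card ((\<lambda>x. x n) ` U)) \<le> covering_number G d \<alpha> U"
    unfolding covering_number_def
  proof (rule INF_greatest)
    fix C assume C: "C \<in> small_covers G d \<alpha> U"
    have "card ((\<lambda>x. x n) ` U) \<le> card C" if "finite C"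
    proof -
      have "U \<subseteq> \<Union>C" using C by (simp add: small_covers_def)
      then have "\<exists>E y. E \<in> C \<and> y \<in> E \<and> y n = a" if "a \<in> (\<lambda>x. x n) ` U" for a
        using that by blast
      then obtain E y where Ey: "\<And>a. a \<in> (\<lambda>x. x n) ` U \<Longrightarrow> E a \<in> C \<and> y a \<in> E a \<and> y a n = a"
        by metis
      have agree: "x n = z n" if "S \<in> C" "x \<in> S" "z \<in> S" for S x z
      proof -
        have "S \<subseteq> G" "ediameter d S \<le> ennreal \<alpha>" using C that by (auto simp: small_covers_def)
        then show ?thesis using that dist_le_iff[OF _ _ assms, of x z] \<open>0 < \<alpha>\<close>
          by (auto simp: ediameter_le_iff)
      qed
      have "inj_on E ((\<lambda>x. x n) ` U)" using Ey agree by (intro inj_onI) metis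
      then show ?thesis using Ey \<open>finite C\<close> by (intro card_inj_on_le[of E]) auto
    qed
    then show "enat (card ((\<lambda>x. x n) ` U)) \<le> (if finite C then enat (card C) else \<infinity>)" by simp
  qed
qed

definition level :: "real \<Rightarrow> nat" where "level \<alpha> = (LEAST n. 1 / l n \<le> \<alpha>)"

lemma inverse_l_level_le: "0 < \<alpha> \<Longrightarrow> 1 / l (level \<alpha>) \<le> \<alpha>"
  unfolding level_def by (metis (mono_tags, lifting) LeastI ex_inverse_l_le)

lemma less_inverse_l_level: "level \<alpha> \<noteq> 0 \<Longrightarrow> \<alpha> < 1 / l (level \<alpha> - 1)"
  using not_less_Least[of "level \<alpha> - 1" "\<lambda>n. 1 / l n \<le> \<alpha>"] by (simp add: level_def[symmetric])

lemma filterlim_level: "filterlim level sequentially (at_right 0)"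
  unfolding filterlim_at_top
proof
  fix n
  have "n \<le> level \<alpha>" if "0 < \<alpha>" "\<alpha> < 1 / l n" for \<alpha>
  proof (rule ccontr)
    assume "\<not> n \<le> level \<alpha>"
    then have "1 / l n \<le> 1 / l (level \<alpha>)" using l_mono[of "level \<alpha>" n]
      by (intro divide_left_mono) auto
    then show False using inverse_l_level_le[OF that(1)] that(2) by linarith
  qed
  then show "\<forall>\<^sub>F \<alpha> in at_right 0. n \<le> level \<alpha>"
    unfolding eventually_at_right_field by (intro exI[of _ "1 / l n"]) auto
qed

lemma log_covering_number_ratio:
  assumes "1 / l n \<le> \<alpha>" "n = 0 \<or> \<alpha> < 1 / l (n - 1)" "\<alpha> < 1"
  shows "log_enat (covering_number G d \<alpha> U) / ereal (ln (1 / \<alpha>)) = ereal (ln (u n) / ln (1 / \<alpha>))"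
proof -
  have "0 < \<alpha>" using assms(1) l_pos[of n] by (smt (verit) divide_pos_pos)
  then have "ln (1 / \<alpha>) \<noteq> 0" using assms(3) by (simp add: ln_div)
  moreover have "card ((\<lambda>x. x n) ` U) \<noteq> 0" using u_pos[of n] by (simp add: u_def)
  ultimately show ?thesis
    using covering_number_eq[OF assms(1,2)] by (simp add: log_enat_def u_def)
qed

lemma filterlim_l_pred: "filterlim (\<lambda>n. l (n - 1)) at_top sequentially"
  by (rule filterlim_compose[OF filterlim_l filterlim_minus_const_nat_at_top])

lemma l_pred_gt_1: "2 \<le> n \<Longrightarrow> 1 < l (n - 1)"
  using l_mono[of 1 "n - 1"] l_ge_2[of 1] by fastforce

lemma lower_box_dim_eq:
  "lower_box_dim G d U = liminf (\<lambda>n. ereal (ln (u n) / ln (l n)))"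
proof (rule antisym)
  have "filterlim (\<lambda>n. 1 / l n) (at_right 0) sequentially"
    using filterlim_compose[OF filterlim_inverse_at_right_top filterlim_l]
    by (simp add: inverse_eq_divide)
  from Liminf_le_Liminf_compose[OF this]
  have "lower_box_dim G d U
      \<le> liminf (\<lambda>n. log_enat (covering_number G d (1 / l n) U) / ereal (ln (1 / (1 / l n))))"
    unfolding lower_box_dim_def .
  also have "\<dots> \<le> liminf (\<lambda>n. ereal (ln (u n) / ln (l n)))"
  proof (rule Liminf_mono)
    have "log_enat (covering_number G d (1 / l n) U) / ereal (ln (1 / (1 / l n)))
        = ereal (ln (u n) / ln (l n))" if "1 \<le> n" for n
      using that l_less[of "n - 1"] l_ge_2[of n]
      by (subst log_covering_number_ratio[of n]) (auto simp: divide_strict_left_mono)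
    then show "\<forall>\<^sub>F n in sequentially.
        log_enat (covering_number G d (1 / l n) U) / ereal (ln (1 / (1 / l n)))
        \<le> ereal (ln (u n) / ln (l n))"
      by (intro eventually_mono[OF eventually_ge_at_top[of 1]]) simp
  qed
  finally show "lower_box_dim G d U \<le> liminf (\<lambda>n. ereal (ln (u n) / ln (l n)))" .
next
  have "liminf (\<lambda>n. ereal (ln (u n) / ln (l n)))
      \<le> Liminf (at_right 0) (\<lambda>\<alpha>. ereal (ln (u (level \<alpha>)) / ln (l (level \<alpha>))))"
    by (rule Liminf_le_Liminf_compose[OF filterlim_level])
  also have "\<dots> \<le> lower_box_dim G d U"
    unfolding lower_box_dim_def
  proof (rule Liminf_mono)
    have "ereal (ln (u (level \<alpha>)) / ln (l (level \<alpha>)))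
        \<le> log_enat (covering_number G d \<alpha> U) / ereal (ln (1 / \<alpha>))" if \<alpha>: "0 < \<alpha>" "\<alpha> < 1" for \<alpha>
    proof -
      have le: "1 / l (level \<alpha>) \<le> \<alpha>" using inverse_l_level_le[OF \<alpha>(1)] .
      then have "1 / \<alpha> \<le> l (level \<alpha>)" using \<alpha>(1) by (simp add: field_simps)
      then have "ln (1 / \<alpha>) \<le> ln (l (level \<alpha>))" using \<alpha> by (intro ln_mono) auto
      moreover have "0 < ln (1 / \<alpha>)" using \<alpha> by (intro ln_gt_zero) simp
      moreover from calculation have "0 < ln (l (level \<alpha>))" by linarith
      ultimately have "ln (u (level \<alpha>)) / ln (l (level \<alpha>)) \<le> ln (u (level \<alpha>)) / ln (1 / \<alpha>)"
        using u_ge_1 by (intro divide_left_mono mult_pos_pos) auto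
      moreover have "level \<alpha> = 0 \<or> \<alpha> < 1 / l (level \<alpha> - 1)" using less_inverse_l_level by blast
      ultimately show ?thesis using log_covering_number_ratio[OF le _ \<alpha>(2)] by simp
    qed
    then show "\<forall>\<^sub>F \<alpha> in at_right 0. ereal (ln (u (level \<alpha>)) / ln (l (level \<alpha>)))
        \<le> log_enat (covering_number G d \<alpha> U) / ereal (ln (1 / \<alpha>))"
      unfolding eventually_at_right_field by (intro exI[of _ 1]) auto
  qed
  finally show "liminf (\<lambda>n. ereal (ln (u n) / ln (l n))) \<le> lower_box_dim G d U" .
qed

lemma upper_box_dim_eq:
  "upper_box_dim G d U = limsup (\<lambda>n. ereal (ln (u n) / ln (l (n - 1))))"
proof (rule antisym)
  have "upper_box_dim G d U
      \<le> Limsup (at_right 0) (\<lambda>\<alpha>. ereal (ln (u (level \<alpha>)) / ln (l (level \<alpha> - 1))))"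
    unfolding upper_box_dim_def
  proof (rule Limsup_mono)
    have "log_enat (covering_number G d \<alpha> U) / ereal (ln (1 / \<alpha>))
        \<le> ereal (ln (u (level \<alpha>)) / ln (l (level \<alpha> - 1)))"
      if \<alpha>: "0 < \<alpha>" "\<alpha> < 1" "2 \<le> level \<alpha>" for \<alpha>
    proof -
      have less: "\<alpha> < 1 / l (level \<alpha> - 1)" using less_inverse_l_level \<alpha>(3) by auto
      then have "l (level \<alpha> - 1) \<le> 1 / \<alpha>" using \<alpha>(1) by (simp add: field_simps)
      moreover have "1 < l (level \<alpha> - 1)" using l_pred_gt_1[OF \<alpha>(3)] .
      ultimately have "ln (u (level \<alpha>)) / ln (1 / \<alpha>) \<le> ln (u (level \<alpha>)) / ln (l (level \<alpha> - 1))"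
        using u_ge_1 \<alpha> by (intro divide_left_mono mult_pos_pos ln_mono) (auto simp: ln_div)
      then show ?thesis
        using log_covering_number_ratio[OF inverse_l_level_le[OF \<alpha>(1)] _ \<alpha>(2)] less by auto
    qed
    moreover have "\<forall>\<^sub>F \<alpha>::real in at_right 0. 0 < \<alpha> \<and> \<alpha> < 1"
      unfolding eventually_at_right_field by (intro exI[of _ 1]) auto
    moreover have "\<forall>\<^sub>F \<alpha> in at_right 0. 2 \<le> level \<alpha>"
      using filterlim_level by (simp add: filterlim_at_top)
    ultimately show "\<forall>\<^sub>F \<alpha> in at_right 0. log_enat (covering_number G d \<alpha> U) / ereal (ln (1 / \<alpha>))
        \<le> ereal (ln (u (level \<alpha>)) / ln (l (level \<alpha> - 1)))"
      by (auto elim: eventually_elim2)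
  qed
  also have "\<dots> \<le> limsup (\<lambda>n. ereal (ln (u n) / ln (l (n - 1))))"
    by (rule Limsup_compose_le_Limsup[OF filterlim_level])
  finally show "upper_box_dim G d U \<le> limsup (\<lambda>n. ereal (ln (u n) / ln (l (n - 1))))" .
next
  text \<open>The supremum over \<open>\<alpha> < 1 / l (n - 1)\<close> is not attained, so we evaluate at a nearby point.\<close>
  define g where "g n = 1 / (l (n - 1) + 1)" for n
  define c where "c n = ln (l (n - 1) + 1) / ln (l (n - 1))" for n
  define f where "f \<alpha> = log_enat (covering_number G d \<alpha> U) / ereal (ln (1 / \<alpha>))" for \<alpha>
  have "((\<lambda>x::real. ln (x + 1) / ln x) \<longlongrightarrow> 1) at_top" by real_asymp
  from filterlim_compose[OF this filterlim_l_pred] have c: "(\<lambda>n. ereal (c n)) \<longlonglongrightarrow> ereal 1"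
    unfolding c_def by (rule tendsto_ereal)
  have "ereal (ln (u n) / ln (l (n - 1))) = ereal (c n) * f (g n)" if "2 \<le> n" for n
  proof -
    have "1 < l (n - 1)" "2 * l (n - 1) \<le> l n"
      using l_pred_gt_1[OF that] l_Suc_ge[of "n - 1"] that by auto
    then have l: "1 < l (n - 1)" "l (n - 1) + 1 \<le> l n" by linarith+
    then have "f (g n) = ereal (ln (u n) / ln (1 / g n))"
      unfolding f_def g_def by (intro log_covering_number_ratio) (auto simp: frac_le frac_less2)
    moreover have "ln (l (n - 1) + 1) \<noteq> 0" using l by (simp add: ln_eq_zero_iff)
    ultimately show ?thesis by (simp add: c_def g_def)
  qed
  then have "\<forall>\<^sub>F n in sequentially. ereal (ln (u n) / ln (l (n - 1))) = ereal (c n) * f (g n)"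
    by (intro eventually_mono[OF eventually_ge_at_top[of 2]])
  then have "limsup (\<lambda>n. ereal (ln (u n) / ln (l (n - 1)))) = limsup (\<lambda>n. ereal (c n) * f (g n))"
    by (rule Limsup_eq)
  also have "\<dots> = limsup (\<lambda>n. f (g n))"
    using ereal_limsup_lim_mult[OF c] by simp
  also have "\<dots> \<le> Limsup (at_right 0) f"
  proof (rule Limsup_compose_le_Limsup)
    have "((\<lambda>x::real. 1 / (x + 1)) \<longlongrightarrow> 0) at_top" by real_asymp
    moreover have "\<forall>\<^sub>F x::real in at_top. 1 / (x + 1) \<in> {0<..}"
      using eventually_gt_at_top[of 0] by eventually_elim simp
    ultimately have "filterlim (\<lambda>x::real. 1 / (x + 1)) (at_right 0) at_top"
      by (simp add: filterlim_at eventually_mono)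
    from filterlim_compose[OF this filterlim_l_pred] show "filterlim g (at_right 0) sequentially"
      unfolding g_def .
  qed
  also have "\<dots> = upper_box_dim G d U" by (simp add: upper_box_dim_def f_def[abs_def])
  finally show "limsup (\<lambda>n. ereal (ln (u n) / ln (l (n - 1)))) \<le> upper_box_dim G d U" .
qed

lemma hausdorff_dim_eq:
  "hausdorff_dim G d U = liminf (\<lambda>n. ereal (ln (u n) / ln (l n)))" (is "_ = ?A")
  unfolding hausdorff_dim_def
proof (rule Sup_ereal_threshold)
  show "0 \<le> ?A"
    using u_ge_1 l_ge_1 by (intro Liminf_bounded always_eventually allI) simp
  show "0 < hausdorff_measure G d 0 U" by (rule hausdorff_measure_0_pos[OF U_nonempty])
  show "0 < hausdorff_measure G d r U" if r: "0 < r" "ereal r < ?A" for r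
  proof (rule hausdorff_measure_pos[OF r(1)])
    show "\<forall>\<^sub>F n in sequentially. l n powr r \<le> u n"
      using less_LiminfD[OF r(2)] eventually_ge_at_top[of 1]
    proof eventually_elim
      case (elim n)
      then show ?case using l_ge_2[of n] le_ln_ratio_iff[of "l n" "u n" r] by simp
    qed
  qed
  show "\<not> 0 < hausdorff_measure G d r U" if r: "0 < r" "?A < ereal r" for r
  proof -
    obtain s where s: "?A < ereal s" "s < r" using ereal_dense2[OF r(2)] by auto
    have "\<exists>\<^sub>F n in sequentially. \<not> ereal s \<le> ereal (ln (u n) / ln (l n))"
      using s(1) Liminf_bounded[of "ereal s" _ sequentially] by (auto simp: frequently_def not_le[symmetric])
    then have "\<exists>\<^sub>F n in sequentially. \<not> ereal s \<le> ereal (ln (u n) / ln (l n)) \<and> 1 \<le> n"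
      by (rule frequently_eventually_frequently[OF _ eventually_ge_at_top])
    then have "\<exists>\<^sub>F n in sequentially. u n \<le> l n powr s"
    proof (rule frequently_elim1)
      fix n assume "\<not> ereal s \<le> ereal (ln (u n) / ln (l n)) \<and> 1 \<le> n"
      then show "u n \<le> l n powr s" using l_ge_2[of n] ln_ratio_le_iff[of "l n" "u n" s] by simp
    qed
    then show ?thesis using hausdorff_measure_eq_0[OF s(2) r(1)] by simp
  qed
qed

lemma packing_dim_eq:
  "packing_dim G d U = limsup (\<lambda>n. ereal (ln (u n) / ln (l (n - 1))))" (is "_ = ?A")
  unfolding packing_dim_def
proof (rule Sup_ereal_threshold)
  have "0 \<le> liminf (\<lambda>n. ereal (ln (u n) / ln (l (n - 1))))"
    using u_ge_1 l_ge_1 by (intro Liminf_bounded always_eventually allI) simp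
  then show "0 \<le> ?A" using Liminf_le_Limsup[OF sequentially_bot] order_trans by blast
  show "0 < packing_measure G d 0 U" by (rule packing_measure_0_pos[OF U_nonempty])
  show "0 < packing_measure G d r U" if r: "0 < r" "ereal r < ?A" for r
  proof -
    obtain t where t: "r < t" "ereal t < ?A" using ereal_dense2[OF r(2)] by auto
    have "\<exists>\<^sub>F n in sequentially. \<not> ereal (ln (u n) / ln (l (n - 1))) \<le> ereal t"
      using t(2) Limsup_bounded[of _ "ereal t" sequentially] by (auto simp: frequently_def not_le[symmetric])
    then have "\<exists>\<^sub>F n in sequentially. \<not> ereal (ln (u n) / ln (l (n - 1))) \<le> ereal t \<and> 2 \<le> n"
      by (rule frequently_eventually_frequently[OF _ eventually_ge_at_top])
    then have "\<exists>\<^sub>F n in sequentially. l (n - 1) powr t \<le> u n"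
    proof (rule frequently_elim1)
      fix n assume "\<not> ereal (ln (u n) / ln (l (n - 1))) \<le> ereal t \<and> 2 \<le> n"
      then show "l (n - 1) powr t \<le> u n"
        using l_pred_gt_1[of n] le_ln_ratio_iff[of "l (n - 1)" "u n" t] by simp
    qed
    then show ?thesis using packing_measure_pos[OF t(1)] r(1) by simp
  qed
  show "\<not> 0 < packing_measure G d r U" if r: "0 < r" "?A < ereal r" for r
  proof -
    obtain s where s: "?A < ereal s" "s < r" using ereal_dense2[OF r(2)] by auto
    have "\<forall>\<^sub>F n in sequentially. u n \<le> l (n - 1) powr s"
      using Limsup_lessD[OF s(1)] eventually_ge_at_top[of 2]
    proof eventually_elim
      case (elim n)
      then show ?case using l_pred_gt_1[of n] ln_ratio_le_iff[of "l (n - 1)" "u n" s] by simp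
    qed
    then show ?thesis using packing_measure_eq_0[OF s(2)] r(1) by simp
  qed
qed

end

theorem theorem3p1:
  fixes L :: "nat \<Rightarrow> ('a, 'b) monoid_scheme"
    and p :: "nat \<Rightarrow> 'a \<Rightarrow> 'a"
    and U :: "(nat \<Rightarrow> 'a) set"
  defines "G \<equiv> carrier (inverse_limit L p)"
    and "d \<equiv> inverse_limit_dist L"
    and "U_proj \<equiv> \<lambda>n. (\<lambda>x. x n) ` U"
  assumes group: "\<And>n. group (L n)"
    and finite: "\<And>n. finite (carrier (L n))"
    and epi: "\<And>n. p n \<in> epi (L (Suc n)) (L n)"
    and trivial: "trivial_group (L 0)"
    and growth: "\<And>n. card (carrier (L (Suc n))) \<ge> 2 * card (carrier (L n))"
    and subgroup: "subgroup U (inverse_limit L p)"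
    and closed: "closedin (inverse_limit_topology L p) U"
  shows "hausdorff_dim G d U = lower_box_dim G d U
    \<and> lower_box_dim G d U =
        liminf (\<lambda>n. ereal (ln (real (card (U_proj n))) / ln (real (card (carrier (L n))))))
    \<and> packing_dim G d U = upper_box_dim G d U
    \<and> upper_box_dim G d U =
        limsup (\<lambda>n. ereal (ln (real (card (U_proj n))) / ln (real (card (carrier (L (n - 1)))))))"
proof -
  have hom: "\<And>n. p n \<in> hom (L (Suc n)) (L n)" using epi by (simp add: epi_def)
  interpret I: closed_subgroup_inverse_limit L p U
    by (rule closed_subgroup_inverse_limit.intro)
      (fact group finite hom trivial growth subgroup closed)+
  show ?thesis
    using I.hausdorff_dim_eq I.lower_box_dim_eq I.packing_dim_eq I.upper_box_dim_eq
    unfolding I.l_def I.u_def G_def d_def U_proj_def by simp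
qed

end
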